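(* Let $\theta_{\rm train},\theta_{\rm ID},\theta_{\rm OOD}\in\mathbb{R}^d$ and $\rho,\rho_{\rm ID},\rho_{\rm OOD}>0$. Let $\mathcal{D}_{n,\theta_{\rm train},\rho}$ be $n$ i.i.d. samples from $P_{\theta_{\rm train},\rho}$, where $(X,Y)\sim P_{\theta_{\rm train},\rho}$ means $Y=\pm1$ uniformly at random and $X|Y\sim\mathcal{N}(Y\theta_{\rm train},(\|\theta_{\rm train}\|/\rho)^2\mathbf{I})$. Let $\hat\theta_{\rm unfiltered}$ be the model trained on the unfiltered data, let $\hat\theta_{\rm pretrained}\in\mathbb{R}^d$ be a given pre-trained model, and assume all models have ${\rm Slope}<1$. (The models, the filtering procedure and ${\rm Slope}$ are defined in the context.) If $${\rm Slope}(\hat\theta_{\rm unfiltered})<{\rm Slope}(\hat\theta_{\rm pretrained})\le 1,$$ then the following holds for any filtering strategy that subsamples each data point $(x_i,y_i)\in\mathcal{D}_{n,\theta_{\rm train},\rho}$ with probability proportional to $h(\langle x_iy_i,\hat\theta_{\rm pretrained}\rangle)$ for some monotonically non-decreasing function $h:\mathbb{R}\to\mathbb{R}_+$: the model $\hat\theta_{\rm filtered}$ trained on the filtered dataset satisfies $${\rm Slope}(\hat\theta_{\rm unfiltered})<{\rm Slope}(\mathbb{E}[\hat\theta_{\rm filtered}])\le{\rm Slope}(\hat\theta_{\rm pretrained}).$$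
   Context: Test distributions. In-distribution (ID): $(X,Y)\sim P_{\theta_{\rm ID},\rho_{\rm ID}}$ with $Y=\pm1$ uniformly at random and $X|Y\sim\mathcal{N}(Y\theta_{\rm ID},(\|\theta_{\rm ID}\|/\rho_{\rm ID})^2\mathbf{I})$. Out-of-distribution (OOD): $P_{\theta_{\rm OOD},\rho_{\rm OOD}}$ is defined in the same way. Slope. With $\cos(u,v)=\langle u,v\rangle/(\|u\|\|v\|)$, $${\rm Slope}(\theta):=\frac{\cos(\theta_{\rm OOD},\theta)\,\rho_{\rm OOD}}{\cos(\theta_{\rm ID},\theta)\,\rho_{\rm ID}}.$$ It is assumed that all models achieve better ID accuracy than OOD accuracy, i.e. ${\rm Slope}(\theta)<1$; a model is more robust if its slope is closer to one. Unfiltered model. $\hat\theta_{\rm unfiltered}=\frac1n\sum_{(x_i,y_i)\in\mathcal{D}_{n,\theta_{\rm train},\rho}}x_iy_i\sim\mathcal{N}(\theta_{\rm train},(\|\theta_{\rm train}\|/(\rho\sqrt n))^2\mathbf{I})$. The slope of this random trained model is, by convention, that of its mean parameter: ${\rm Slope}(\hat\theta_{\rm unfiltered})={\rm Slope}(\theta_{\rm train})$. Pre-trained model. $\hat\theta_{\rm pretrained}$ is treated as a fixed vector in $\mathbb{R}^d$. Filtered model. Each data point is kept with probability $\mathbb{P}((x_i,y_i)\text{ passes the filter})\propto h(\langle x_iy_i,\hat\theta_{\rm pretrained}\rangle)$, and $\hat\theta_{\rm filtered}=\frac1m\sum_{(x_i,y_i)\in\text{filtered dataset}}x_iy_i$,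 where $m$ is the number of samples in the filtered dataset. ${\rm Slope}(\mathbb{E}[\hat\theta_{\rm filtered}])$ is the slope of the linear trend of a model trained on the filtered data.
   Formalization: h is assumed non-constant: for constant h > 0, E[θ_filtered] = θ_train and the strict inequality fails; for h = 0 nothing is kept. Points are kept independently with probability κh for a fixed κ > 0, and both given models are assumed to have better ID than OOD accuracy. *)

theory Defs
  imports "HOL-Probability.Probability"
begin

(* The normal distribution N(mu, s^2 I) for s > 0. *)
definition isotropic_normal :: "real ^ 'd \<Rightarrow> real \<Rightarrow> (real ^ 'd) measure" where
  "isotropic_normal \<mu> s =
     density lborel (\<lambda>x. ennreal (\<Prod>i\<in>UNIV. normal_density (\<mu> $ i) s (x $ i)))"

(* The joint law of (X, Y), features in the first component, labels +1/-1 in the second.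
   Only used for \<theta> \<noteq> 0 and \<rho> > 0. *)
definition data_dist :: "real ^ 'd \<Rightarrow> real \<Rightarrow> ((real ^ 'd) \<times> real) measure" where
  "data_dist \<theta> \<rho> =
     measure_pmf (pmf_of_set {-1, 1}) \<bind>
       (\<lambda>y. distr (isotropic_normal (y *\<^sub>R \<theta>) (norm \<theta> / \<rho>)) (borel \<Otimes>\<^sub>M borel) (\<lambda>x. (x, y)))"

definition cosine :: "real ^ 'd \<Rightarrow> real ^ 'd \<Rightarrow> real" where
  "cosine u v = (u \<bullet> v) / (norm u * norm v)"

(* Meaningful only if cosine \<theta>ID \<theta> \<noteq> 0. *)
definition slope :: "real ^ 'd \<Rightarrow> real \<Rightarrow> real ^ 'd \<Rightarrow> real \<Rightarrow> real ^ 'd \<Rightarrow> real" where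
  "slope \<theta>ID \<rho>ID \<theta>OOD \<rho>OOD \<theta> =
     (cosine \<theta>OOD \<theta> * \<rho>OOD) / (cosine \<theta>ID \<theta> * \<rho>ID)"

(* The accuracy on P of the linear classifier that predicts the sign of the inner product of x and w. *)
definition accuracy :: "((real ^ 'd) \<times> real) measure \<Rightarrow> real ^ 'd \<Rightarrow> real" where
  "accuracy P w = measure P {(x, y) \<in> space P. 0 < y * (x \<bullet> w)}"

(* The model trained on the data points with index in I. *)
definition trained_model :: "nat set \<Rightarrow> (nat \<Rightarrow> real ^ 'd) \<Rightarrow> (nat \<Rightarrow> real) \<Rightarrow> real ^ 'd" where
  "trained_model I x y = (1 / real (card I)) *\<^sub>R (\<Sum>i\<in>I. y i *\<^sub>R x i)"

definition mean_unfiltered ::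
    "'w measure \<Rightarrow> nat \<Rightarrow> (nat \<Rightarrow> 'w \<Rightarrow> real ^ 'd) \<Rightarrow> (nat \<Rightarrow> 'w \<Rightarrow> real) \<Rightarrow> real ^ 'd" where
  "mean_unfiltered M n X Y =
     (LINT \<omega>|M. trained_model {..<n} (\<lambda>i. X i \<omega>) (\<lambda>i. Y i \<omega>))"

(* K i \<omega> says that data point i passes the filter.  The filtered model is an average over the
   points kept, so it exists only if at least one point is kept; its expectation is taken
   conditionally on that event. *)
definition mean_filtered ::
    "'w measure \<Rightarrow> nat \<Rightarrow> (nat \<Rightarrow> 'w \<Rightarrow> real ^ 'd) \<Rightarrow> (nat \<Rightarrow> 'w \<Rightarrow> real) \<Rightarrow>
      (nat \<Rightarrow> 'w \<Rightarrow> bool) \<Rightarrow> real ^ 'd" where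
  "mean_filtered M n X Y K =
     (LINT \<omega>|uniform_measure M {\<omega> \<in> space M. \<exists>i<n. K i \<omega>}.
        trained_model {i. i < n \<and> K i \<omega>} (\<lambda>i. X i \<omega>) (\<lambda>i. Y i \<omega>))"

(* n i.i.d. samples from P, the i-th of which is kept (K i), independently of the others, with
   conditional probability q (x, y) given (X i, Y i) = (x, y). *)
definition filtered_sample ::
    "'w measure \<Rightarrow> nat \<Rightarrow> ((real ^ 'd) \<times> real) measure \<Rightarrow> ((real ^ 'd) \<times> real \<Rightarrow> real) \<Rightarrow>
      (nat \<Rightarrow> 'w \<Rightarrow> real ^ 'd) \<Rightarrow> (nat \<Rightarrow> 'w \<Rightarrow> real) \<Rightarrow> (nat \<Rightarrow> 'w \<Rightarrow> bool) \<Rightarrow> bool" where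
  "filtered_sample M n P q X Y K \<longleftrightarrow>
     prob_space M \<and>
     prob_space.indep_vars M (\<lambda>_. (borel \<Otimes>\<^sub>M borel) \<Otimes>\<^sub>M count_space UNIV)
       (\<lambda>i \<omega>. ((X i \<omega>, Y i \<omega>), K i \<omega>)) {..<n} \<and>
     (\<forall>i<n. distr M (borel \<Otimes>\<^sub>M borel) (\<lambda>\<omega>. (X i \<omega>, Y i \<omega>)) = P) \<and>
     (\<forall>i<n. AE \<omega> in M.
        real_cond_exp M
          (vimage_algebra (space M) (\<lambda>\<omega>. (X i \<omega>, Y i \<omega>)) (borel \<Otimes>\<^sub>M borel))
          (indicator {\<omega> \<in> space M. K i \<omega>}) \<omega> = q (X i \<omega>, Y i \<omega>))"

end

theory Submission
  imports Defs
begin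

text \<open>
  Write Z = Y X, which is distributed as N(\<theta>train, s^2 I). Given the set of kept indices, the kept
  Z's are still i.i.d., so the filtered mean is E[Z h(Z \<bullet> \<theta>pre)] / E[h(Z \<bullet> \<theta>pre)]. Reflecting in
  a direction orthogonal to \<theta>pre shows that only the component of Z - \<theta>train along \<theta>pre is
  affected by the weight, and since h is monotone and not constant it is shifted by a positive amount.
  Hence the filtered mean is \<theta>train + c \<theta>pre with c > 0. Up to a common positive factor a
  slope is the quotient of two linear functionals; the accuracy and slope assumptions make the
  denominator positive at both \<theta>train and \<theta>pre, and the claim is the mediant inequality.
\<close>

subsection \<open>Isotropic normal distributions\<close>

text \<open>Two obstacles shape the computation of the filtered mean. The number of kept points is
  random and stands in the denominator; rather than conditioning on the kept set, the average is
  written with leave-one-out weights, each independent of the point that it multiplies, and their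
  total expectation cancels against the probability that some point is kept. Moreover
  \<open>h\<close> may be unbounded as far as the hypotheses say, so integrability has to come from
  elsewhere: \<open>\<kappa> * h\<close> is a conditional probability, hence at most 1 almost
  surely, and since the projection on \<theta>pre has full support and \<open>h\<close> is monotone,
  the bound extends to the whole real line. Strictness of the shift rests on \<open>h\<close> not
  being constant, since a constant \<open>h\<close> would leave the mean at \<theta>train.\<close>

text \<open>
  The library's change of variables needs a well-ordered index type of the vectors. An orthogonal map
  sends balls to balls of the same radius, so a Vitali covering by disjoint balls is enough.
\<close>

lemma emeasure_orthogonal_image_ge:
  fixes T :: "'a::euclidean_space \<Rightarrow> 'a"
  assumes T: "orthogonal_transformation T" and "open U"
  shows "emeasure lborel U \<le> emeasure lborel (T ` U)"
proof -
  define K where "K = {(x, r). ball x r \<subseteq> U}"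
  have "\<exists>i. i \<in> K \<and> x \<in> ball (fst i) (snd i) \<and> snd i < d" if x: "x \<in> U" and d: "0 < d" for x d
  proof -
    obtain e where e: "e > 0" "ball x e \<subseteq> U"
      using openE[OF \<open>open U\<close> x] by blast
    have "ball x (min e (d / 2)) \<subseteq> U"
      using e by (auto simp: ball_def)
    then show ?thesis
      using e d by (intro exI[of _ "(x, min e (d / 2))"]) (auto simp: K_def)
  qed
  then obtain C where C: "countable C" "C \<subseteq> K"
    and disj: "pairwise (\<lambda>i j. disjnt (ball (fst i) (snd i)) (ball (fst j) (snd j))) C"
    and negl: "negligible (U - (\<Union>i\<in>C. ball (fst i) (snd i)))"
    by (rule Vitali_covering_theorem_balls[where S = U and K = K]) auto
  let ?B = "\<lambda>i. ball (fst i) (snd i)"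
  have inj: "inj T"
    using T by (rule orthogonal_transformation_inj)
  have img: "T ` ball x r = ball (T x) r" for x r
    using T by (rule image_orthogonal_transformation_ball)
  have df: "disjoint_family_on ?B C"
    using disj by (auto simp: disjoint_family_on_def pairwise_def disjnt_def)
  then have df': "disjoint_family_on (\<lambda>i. T ` ?B i) C"
    by (simp add: disjoint_family_on_def image_Int[OF inj, symmetric])
  have "U - (\<Union>i\<in>C. ?B i) \<in> sets lborel"
    using \<open>open U\<close> by (simp add: borel_open open_UN sets.Diff)
  then have "U - (\<Union>i\<in>C. ?B i) \<in> null_sets lborel"
    using negl by (simp add: negligible_iff_null_sets null_sets_completion_iff)
  then have "emeasure lborel U \<le> emeasure lborel (\<Union>i\<in>C. ?B i)"
    using emeasure_Un_null_set[of "\<Union>i\<in>C. ?B i" lborel "U - (\<Union>i\<in>C. ?B i)"]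
      emeasure_mono[of U "(\<Union>i\<in>C. ?B i) \<union> (U - (\<Union>i\<in>C. ?B i))" lborel] \<open>open U\<close>
    by (simp add: open_UN borel_open)
  also have "\<dots> = (\<integral>\<^sup>+i. emeasure lborel (?B i) \<partial>count_space C)"
    using C df by (intro emeasure_UN_countable) auto
  also have "\<dots> = (\<integral>\<^sup>+i. emeasure lborel (T ` ?B i) \<partial>count_space C)"
  proof (rule nn_integral_cong)
    fix i :: "'a \<times> real"
    \<comment> \<open>\<open>K\<close> does not restrict radii to be positive, so a selected ball
      may be empty.\<close>
    show "emeasure lborel (?B i) = emeasure lborel (T ` ?B i)"
      by (cases "snd i \<ge> 0") (simp_all add: img emeasure_ball ball_empty not_le less_imp_le)
  qed
  also have "\<dots> = emeasure lborel (\<Union>i\<in>C. T ` ?B i)"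
    using C df' by (intro emeasure_UN_countable[symmetric]) (auto simp: img)
  \<comment> \<open>Nothing is known yet about the image of the uncovered null set, so only an
    inclusion is used. The reverse inequality will come from the inverse map.\<close>
  also have "\<dots> \<le> emeasure lborel (T ` U)"
  proof (rule emeasure_mono)
    show "(\<Union>i\<in>C. T ` ?B i) \<subseteq> T ` U"
      using C by (fastforce simp: K_def)
    show "T ` U \<in> sets lborel"
      using open_surjective_linear_image[OF \<open>open U\<close>, of T] T
      by (simp add: borel_open orthogonal_transformation_linear orthogonal_transformation_surj)
  qed
  finally show ?thesis .
qed

lemma orthogonal_transformation_borel_measurable:
  fixes T :: "'a::euclidean_space \<Rightarrow> 'a"
  shows "orthogonal_transformation T \<Longrightarrow> T \<in> borel_measurable borel"
  by (intro borel_measurable_continuous_onI linear_continuous_on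
      linear_conv_bounded_linear[THEN iffD1] orthogonal_transformation_linear)

text \<open>The volume inequality for \<open>T\<close> and for its inverse \<open>S\<close> gives
  equality on open boxes, and the volumes of boxes characterise Lebesgue measure.\<close>

lemma lborel_distr_orthogonal:
  fixes T :: "'a::euclidean_space \<Rightarrow> 'a"
  assumes T: "orthogonal_transformation T"
  shows "distr lborel borel T = lborel"
proof (rule lborel_eqI[symmetric])
  obtain S where S: "orthogonal_transformation S" "\<And>x. T (S x) = x" "\<And>x. S (T x) = x"
    using T by (metis orthogonal_transformation_inv orthogonal_transformation_inj
        orthogonal_transformation_surj inv_f_f surj_f_inv_f)
  have meas: "T \<in> borel_measurable borel"
    using T by (rule orthogonal_transformation_borel_measurable)
  fix l u :: 'a
  assume lu: "\<And>b. b \<in> Basis \<Longrightarrow> l \<bullet> b \<le> u \<bullet> b"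
  have eq: "T -` box l u = S ` box l u" "T ` (S ` box l u) = box l u"
    using S by (auto simp: image_iff) metis+
  have op: "open (S ` box l u)"
    using open_surjective_linear_image[OF open_box, of S] S
    by (simp add: orthogonal_transformation_linear orthogonal_transformation_surj)
  have "emeasure lborel (S ` box l u) = emeasure lborel (box l u)"
    using emeasure_orthogonal_image_ge[OF S(1), of "box l u"]
      emeasure_orthogonal_image_ge[OF T op] by (simp add: eq open_box)
  then show "emeasure (distr lborel borel T) (box l u) = (\<Prod>b\<in>Basis. (u - l) \<bullet> b)"
    using lu meas by (simp add: emeasure_distr eq emeasure_lborel_box)
qed simp

text \<open>In this form the density depends on \<open>x\<close> only through its distance from
  \<mu>, which makes the centred law invariant under orthogonal maps.\<close>

lemma normal_density_prod_eq:
  fixes \<mu> x :: "real ^ 'd"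
  assumes "s > 0"
  shows "(\<Prod>i\<in>UNIV. normal_density (\<mu> $ i) s (x $ i)) =
    (1 / sqrt (2 * pi * s\<^sup>2)) ^ CARD('d) * exp (- (norm (x - \<mu>))\<^sup>2 / (2 * s\<^sup>2))"
  by (simp add: normal_density_def prod_dividef power_divide exp_sum[symmetric] sum_negf
      sum_divide_distrib[symmetric] power2_norm_eq_inner inner_vec_def power2_eq_square[symmetric])

section \<open>Orthogonal and affine images of isotropic normal laws\<close>

lemma isotropic_normal_density_measurable [measurable]:
  fixes \<mu> :: "real ^ 'd"
  shows "(\<lambda>x. ennreal (\<Prod>i\<in>UNIV. normal_density (\<mu> $ i) s (x $ i))) \<in> borel_measurable borel"
  by measurable

lemma sets_isotropic_normal [simp, measurable_cong]: "sets (isotropic_normal \<mu> s) = sets borel"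
  and space_isotropic_normal [simp]: "space (isotropic_normal \<mu> s) = UNIV"
  by (simp_all add: isotropic_normal_def)

text \<open>Not a point mass: with scale 0 the normalising factor is 1 / 0, which is 0 by the
  convention on division, so the density vanishes.\<close>

lemma isotropic_normal_0: "isotropic_normal (\<mu> :: real ^ 'd) 0 = null_measure borel"
proof (rule measure_eqI)
  fix A
  have "(\<lambda>x :: real ^ 'd. ennreal (\<Prod>i\<in>UNIV. normal_density (\<mu> $ i) 0 (x $ i))) = (\<lambda>_. 0)"
    by (simp add: normal_density_def power_0_left)
  then show "emeasure (isotropic_normal \<mu> 0) A = emeasure (null_measure borel) A"
    by (simp only: isotropic_normal_def null_measure_eq_density[symmetric] emeasure_null_measure)
qed simp

lemma isotropic_normal_orthogonal:
  fixes T :: "real ^ 'd \<Rightarrow> real ^ 'd"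
  assumes T: "orthogonal_transformation T" and "s > 0"
  shows "distr (isotropic_normal 0 s) borel T = isotropic_normal 0 s"
proof -
  have [measurable]: "T \<in> borel_measurable borel"
    using T by (rule orthogonal_transformation_borel_measurable)
  have "isotropic_normal 0 s = density (distr lborel borel T)
      (\<lambda>x. ennreal (\<Prod>i\<in>UNIV. normal_density (0 $ i) s (x $ i)))"
    by (simp add: isotropic_normal_def lborel_distr_orthogonal[OF T])
  also have "\<dots> = distr (isotropic_normal 0 s) borel T"
    using orthogonal_transformation_norm[OF T] \<open>s > 0\<close>
    by (simp add: density_distr isotropic_normal_def normal_density_prod_eq
        del: zero_index)
  finally show ?thesis ..
qed

text \<open>The Jacobian factor \<open>s ^ CARD('d)\<close> is absorbed by the normalising constants
  of the coordinates. This reduces later computations to the standard Gaussian.\<close>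

lemma isotropic_normal_affine:
  fixes \<mu> :: "real ^ 'd"
  assumes "s > 0"
  shows "isotropic_normal \<mu> s = distr (isotropic_normal 0 1) borel (\<lambda>x. \<mu> + s *\<^sub>R x)"
proof -
  let ?\<phi> = "\<lambda>x. ennreal (\<Prod>i\<in>UNIV. normal_density (\<mu> $ i) s (x $ i))"
  have "lborel = density (distr lborel borel (\<lambda>x. \<mu> + s *\<^sub>R x)) (\<lambda>_. ennreal (s ^ CARD('d)))"
    using lborel_affine[OF less_imp_neq[OF assms, symmetric], of \<mu>]
    unfolding abs_of_pos[OF assms] DIM_cart DIM_real mult_1_right .
  then have "isotropic_normal \<mu> s = density (density (distr lborel borel (\<lambda>x. \<mu> + s *\<^sub>R x))
      (\<lambda>_. ennreal (s ^ CARD('d)))) ?\<phi>"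
    unfolding isotropic_normal_def by (rule arg_cong)
  also have "\<dots> = distr (density lborel (\<lambda>x. ennreal (s ^ CARD('d)) * ?\<phi> (\<mu> + s *\<^sub>R x))) borel
      (\<lambda>x. \<mu> + s *\<^sub>R x)"
    by (simp add: density_density_eq density_distr)
  also have "(\<lambda>x. ennreal (s ^ CARD('d)) * ?\<phi> (\<mu> + s *\<^sub>R x)) =
      (\<lambda>x. ennreal (\<Prod>i\<in>UNIV. normal_density ((0 :: real ^ 'd) $ i) 1 (x $ i)))"
  proof
    fix x :: "real ^ 'd"
    have "s * (1 / sqrt (2 * pi * s\<^sup>2)) = 1 / sqrt (2 * pi * 1\<^sup>2)"
      using assms by (simp add: real_sqrt_mult)
    then have pow: "s ^ CARD('d) * (1 / sqrt (2 * pi * s\<^sup>2)) ^ CARD('d) =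
        (1 / sqrt (2 * pi * 1\<^sup>2)) ^ CARD('d)"
      by (simp only: power_mult_distrib[symmetric])
    have exponent: "- (norm (\<mu> + s *\<^sub>R x - \<mu>))\<^sup>2 / (2 * s\<^sup>2) = - (norm (x - 0))\<^sup>2 / (2 * 1\<^sup>2)"
      using assms by (simp add: power_mult_distrib)
    have "s ^ CARD('d) * (\<Prod>i\<in>UNIV. normal_density (\<mu> $ i) s ((\<mu> + s *\<^sub>R x) $ i)) =
        (\<Prod>i\<in>UNIV. normal_density ((0 :: real ^ 'd) $ i) 1 (x $ i))"
      unfolding normal_density_prod_eq[OF assms] normal_density_prod_eq[OF zero_less_one] exponent
        pow[symmetric] by (rule mult.assoc[symmetric])
    moreover have "ennreal (s ^ CARD('d)) * ?\<phi> (\<mu> + s *\<^sub>R x) = ennreal (s ^ CARD('d) *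
        (\<Prod>i\<in>UNIV. normal_density (\<mu> $ i) s ((\<mu> + s *\<^sub>R x) $ i)))"
      using assms by (intro ennreal_mult[symmetric] prod_nonneg) auto
    ultimately show "ennreal (s ^ CARD('d)) * ?\<phi> (\<mu> + s *\<^sub>R x) =
        ennreal (\<Prod>i\<in>UNIV. normal_density ((0 :: real ^ 'd) $ i) 1 (x $ i))"
      by (simp only:)
  qed
  finally show ?thesis
    by (simp add: isotropic_normal_def)
qed

section \<open>The standard Gaussian: total mass, first moments, full support\<close>

abbreviation std_gauss :: "(real ^ 'd) measure" where
  "std_gauss \<equiv> isotropic_normal 0 1"

lemma nn_integral_lborel_vec_prod:
  fixes f :: "'d::finite \<Rightarrow> real \<Rightarrow> ennreal"
  assumes [measurable]: "\<And>i. f i \<in> borel_measurable borel"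
  shows "(\<integral>\<^sup>+x. (\<Prod>i\<in>UNIV. f i (x $ i)) \<partial>(lborel :: (real ^ 'd) measure)) =
    (\<Prod>i\<in>UNIV. \<integral>\<^sup>+x. f i x \<partial>lborel)"
proof -
  \<comment> \<open>\<open>g\<close> recovers the coordinate that belongs to a basis vector, so that
    the product formula over \<open>Basis\<close> applies; on \<open>Basis\<close> the index is
    unique.\<close>
  define g where "g b = f (THE i. b = axis i (1::real))" for b :: "real ^ 'd"
  have g: "g (axis i 1) = f i" for i
    by (simp add: g_def axis_eq_axis)
  have B: "(Basis :: (real ^ 'd) set) = (\<lambda>i. axis i 1) ` UNIV"
    by (auto simp: Basis_vec_def)
  have inj: "inj (\<lambda>i::'d. axis i (1::real))"
    by (auto simp: inj_on_def axis_eq_axis)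
  have "(\<integral>\<^sup>+x. (\<Prod>b\<in>Basis. g b (x \<bullet> b)) \<partial>(lborel :: (real ^ 'd) measure)) =
      (\<Prod>b\<in>Basis. \<integral>\<^sup>+x. g b x \<partial>lborel)"
    by (rule nn_integral_lborel_prod) (auto simp: B g)
  then show ?thesis
    using inj by (simp add: B prod.reindex g inner_axis)
qed

lemma prob_space_std_gauss: "prob_space (std_gauss :: (real ^ 'd) measure)"
proof
  have "emeasure (std_gauss :: (real ^ 'd) measure) UNIV =
      (\<integral>\<^sup>+x. (\<Prod>i\<in>UNIV. ennreal (std_normal_density (x $ i))) \<partial>(lborel :: (real ^ 'd) measure))"
    by (simp add: isotropic_normal_def emeasure_density prod_ennreal)
  also have "\<dots> = 1"
    by (subst nn_integral_lborel_vec_prod) (auto simp: nn_integral_eq_integral)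
  finally show "emeasure (std_gauss :: (real ^ 'd) measure) (space std_gauss) = 1"
    by simp
qed

lemma prob_space_isotropic_normal:
  assumes "s > 0"
  shows "prob_space (isotropic_normal \<mu> s)"
  unfolding isotropic_normal_affine[OF assms]
  by (intro prob_space.prob_space_distr prob_space_std_gauss) simp

lemma integrable_std_gauss_component: "integrable std_gauss (\<lambda>x :: real ^ 'd. x $ i)"
proof (rule integrableI_bounded)
  \<comment> \<open>The moment factors over the coordinates: coordinate \<open>i\<close> contributes
    the first absolute moment of a standard normal variable, every other one its total mass
    1.\<close>
  have "(\<integral>\<^sup>+x. ennreal (norm (x $ i)) \<partial>(std_gauss :: (real ^ 'd) measure)) =
      (\<integral>\<^sup>+x. (\<Prod>j\<in>UNIV. ennreal (std_normal_density (x $ j) * (if j = i then \<bar>x $ j\<bar> else 1)))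
        \<partial>(lborel :: (real ^ 'd) measure))"
    by (simp add: isotropic_normal_def nn_integral_density prod_ennreal prod.distrib
        ennreal_mult[symmetric] prod_nonneg)
  also have "\<dots> = (\<Prod>j\<in>UNIV. \<integral>\<^sup>+t. ennreal (std_normal_density t * (if j = i then \<bar>t\<bar> else 1)) \<partial>lborel)"
    by (subst nn_integral_lborel_vec_prod) auto
  also have "\<dots> < \<infinity>"
  proof -
    have "(\<integral>\<^sup>+t. ennreal (std_normal_density t * (if j = i then \<bar>t\<bar> else 1)) \<partial>lborel) < \<infinity>" for j
    proof (cases "j = i")
      case True
      then show ?thesis
        using integrable_std_normal_moment_abs[of 1] by (simp add: nn_integral_eq_integral)
    next
      case False
      then show ?thesis
        by (simp add: nn_integral_eq_integral)
    qed
    then show ?thesis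
      by (simp add: less_top[symmetric] ennreal_prod_eq_top)
  qed
  finally show "(\<integral>\<^sup>+x. ennreal (norm (x $ i)) \<partial>(std_gauss :: (real ^ 'd) measure)) < \<infinity>" .
qed simp

lemma integrable_std_gauss: "integrable std_gauss (\<lambda>x :: real ^ 'd. x)"
proof (rule Bochner_Integration.integrable_bound)
  show "integrable std_gauss (\<lambda>x :: real ^ 'd. \<Sum>i\<in>UNIV. \<bar>x $ i\<bar>)"
    by (intro Bochner_Integration.integrable_sum integrable_abs integrable_std_gauss_component)
  show "AE x in std_gauss. norm (x :: real ^ 'd) \<le> norm (\<Sum>i\<in>UNIV. \<bar>x $ i\<bar>)"
    by (simp add: norm_le_l1_cart sum_nonneg)
qed simp

text \<open>The density is positive everywhere, so a Gaussian null set is Lebesgue null, which a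
  nonempty open set is not. This is the full support by which almost sure statements become
  pointwise ones.\<close>

lemma emeasure_std_gauss_pos:
  fixes U :: "(real ^ 'd) set"
  assumes "open U" "U \<noteq> {}"
  shows "emeasure std_gauss U \<noteq> 0"
proof
  have [measurable]: "U \<in> sets borel"
    using assms by simp
  have pos: "(\<Prod>i\<in>UNIV. normal_density ((0 :: real ^ 'd) $ i) 1 (x $ i)) > 0" for x :: "real ^ 'd"
    by (simp add: prod_pos normal_density_pos)
  assume "emeasure std_gauss U = 0"
  then have "AE x in lborel. ennreal (\<Prod>i\<in>UNIV. normal_density ((0 :: real ^ 'd) $ i) 1 (x $ i)) *
      indicator U x = 0"
    by (simp add: isotropic_normal_def emeasure_density nn_integral_0_iff_AE del: zero_index)
  then have "AE x in lborel. x \<notin> U"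
    by eventually_elim
      (use pos in \<open>auto simp: indicator_def ennreal_eq_0_iff not_le[symmetric] simp del: zero_index split: if_splits\<close>)
  then have "U \<in> null_sets lborel"
    using assms by (simp add: AE_iff_null_sets)
  then show False
    using assms open_not_negligible[of U]
    by (auto simp: negligible_iff_null_sets null_sets_completion_iff)
qed

subsection \<open>Monotone ridge weights\<close>

text \<open>Reflection in the hyperplane orthogonal to \<open>v\<close>: it negates the component
  along \<open>v\<close> and fixes every vector orthogonal to \<open>v\<close>. For
  \<open>v = 0\<close> it is the identity, so it is orthogonal for every \<open>v\<close>.\<close>

lemma orthogonal_transformation_reflection:
  fixes v :: "'a::real_inner"
  shows "orthogonal_transformation (\<lambda>x. x - (2 * (x \<bullet> v) / (v \<bullet> v)) *\<^sub>R v)"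
  unfolding orthogonal_transformation_def
proof (intro conjI allI)
  show "linear (\<lambda>x. x - (2 * (x \<bullet> v) / (v \<bullet> v)) *\<^sub>R v)"
    by (intro linear_compose_sub linear_id[unfolded id_def] linear_compose_scale_right)
       (auto intro!: linearI simp: inner_add_left distrib_left add_divide_distrib
          scaleR_add_left[symmetric])
  fix x y :: 'a
  show "(x - (2 * (x \<bullet> v) / (v \<bullet> v)) *\<^sub>R v) \<bullet> (y - (2 * (y \<bullet> v) / (v \<bullet> v)) *\<^sub>R v) = x \<bullet> y"
  proof (cases "v = 0")
    case False
    define k where "k = v \<bullet> v"
    have "k \<noteq> 0"
      using False by (simp add: k_def)
    then show ?thesis
      unfolding inner_diff_left inner_diff_right inner_scaleR_left inner_scaleR_right
        inner_commute[of v y] k_def[symmetric]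
      by (simp add: field_simps)
  qed simp
qed

lemma integral_std_gauss_odd:
  fixes g :: "real ^ 'd \<Rightarrow> 'b::{banach, second_countable_topology}"
  assumes T: "orthogonal_transformation T" and [measurable]: "g \<in> borel_measurable borel"
    and odd: "\<And>x. g (T x) = - g x"
  shows "(LINT x|std_gauss. g x) = 0"
proof -
  have [measurable]: "T \<in> borel_measurable borel"
    using T by (rule orthogonal_transformation_borel_measurable)
  have "(LINT x|std_gauss. g x) = (LINT x|distr std_gauss borel T. g x)"
    by (simp add: isotropic_normal_orthogonal[OF T])
  also have "\<dots> = (LINT x|std_gauss. g (T x))"
    by (rule integral_distr) simp_all
  also have "\<dots> = - (LINT x|std_gauss. g x)"
    by (simp add: odd)
  finally have "(LINT x|std_gauss. g x) + (LINT x|std_gauss. g x) = 0"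
    by (simp only: eq_neg_iff_add_eq_0)
  then have "(2::real) *\<^sub>R (LINT x|std_gauss. g x) = 0"
    by (simp only: scaleR_2)
  then show ?thesis
    by simp
qed

lemma integral_std_gauss: "(LINT x|std_gauss. x) = (0 :: real ^ 'd)"
  by (rule integral_std_gauss_odd[of uminus])
     (simp_all add: orthogonal_transformation_def linear_iff)

lemma integral_std_gauss_ridge_orthogonal:
  fixes p v :: "real ^ 'd"
  assumes "v \<bullet> p = 0" and [measurable]: "f \<in> borel_measurable borel"
  shows "(LINT x|std_gauss. f (x \<bullet> p) * (x \<bullet> v)) = (0 :: real)"
proof (rule integral_std_gauss_odd[OF orthogonal_transformation_reflection[of v]])
  show "f ((x - (2 * (x \<bullet> v) / (v \<bullet> v)) *\<^sub>R v) \<bullet> p) *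
      ((x - (2 * (x \<bullet> v) / (v \<bullet> v)) *\<^sub>R v) \<bullet> v) = - (f (x \<bullet> p) * (x \<bullet> v))" for x
    using assms(1) by (cases "v = 0") (simp_all add: inner_diff_left)
qed measurable

lemma integrable_std_gauss_bounded_mult:
  fixes f :: "real ^ 'd \<Rightarrow> real"
  assumes [measurable]: "f \<in> borel_measurable borel" and "\<And>x. \<bar>f x\<bar> \<le> B"
  shows "integrable std_gauss (\<lambda>x. f x *\<^sub>R x)"
proof (rule Bochner_Integration.integrable_bound)
  show "integrable std_gauss (\<lambda>x :: real ^ 'd. B *\<^sub>R x)"
    by (intro integrable_scaleR_right integrable_std_gauss)
  have "\<bar>f x\<bar> \<le> \<bar>B\<bar>" for x
    using assms(2)[of x] by linarith
  then show "AE x in std_gauss. norm (f x *\<^sub>R x) \<le> norm (B *\<^sub>R x)"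
    by (simp add: mult_right_mono)
qed measurable

text \<open>The weighted mean \<open>V\<close> is orthogonal to every \<open>v\<close> orthogonal to
  \<open>p\<close>. Applied to the part of \<open>V\<close> that is orthogonal to \<open>p\<close>,
  this makes that part orthogonal to itself, so \<open>V\<close> is a multiple of \<open>p\<close>;
  the sign of the multiple is that of \<open>V \<bullet> p\<close>.\<close>

lemma std_gauss_ridge_mean:
  fixes p :: "real ^ 'd" and f :: "real \<Rightarrow> real"
  assumes "p \<noteq> 0" "mono f" and bounded: "\<And>u. \<bar>f u\<bar> \<le> B" and nonconst: "\<not> f constant_on UNIV"
  shows "\<exists>c>0. (LINT x|std_gauss. f (x \<bullet> p) *\<^sub>R x) = c *\<^sub>R p"
proof -
  have [measurable]: "f \<in> borel_measurable borel"
    using \<open>mono f\<close> by (rule borel_measurable_mono)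
  have int: "integrable std_gauss (\<lambda>x. f (x \<bullet> p) *\<^sub>R x)"
    using bounded by (intro integrable_std_gauss_bounded_mult) auto
  define V where "V = (LINT x|std_gauss. f (x \<bullet> p) *\<^sub>R x)"
  have V: "V \<bullet> v = (LINT x|std_gauss. f (x \<bullet> p) * (x \<bullet> v))" for v
    unfolding V_def using integral_inner_left[OF int, of v] by simp
  define c where "c = (V \<bullet> p) / (p \<bullet> p)"
  have pp: "p \<bullet> p > 0"
    using \<open>p \<noteq> 0\<close> by simp
  define v where "v = V - c *\<^sub>R p"
  have vp: "v \<bullet> p = 0"
    using pp by (simp add: v_def c_def inner_diff_left)
  then have Vv: "V \<bullet> v = 0"
    unfolding V by (rule integral_std_gauss_ridge_orthogonal) simp
  have "v \<bullet> v = (V - c *\<^sub>R p) \<bullet> v"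
    by (simp only: v_def[symmetric])
  also have "\<dots> = 0"
    by (simp add: inner_diff_left inner_commute[of p] Vv vp)
  finally have "v = 0"
    by simp
  then have V_eq: "V = c *\<^sub>R p"
    by (simp add: v_def)
  \<comment> \<open>Subtracting \<open>f 0\<close> does not change the integral, because
    \<open>x \<bullet> p\<close> has mean 0, and by monotonicity it makes the integrand nonnegative:
    both factors have the same sign.\<close>
  let ?g = "\<lambda>x. (f (x \<bullet> p) - f 0) * (x \<bullet> p)"
  have mono: "f a \<le> f b" if "a \<le> b" for a b
    using \<open>mono f\<close> that by (rule monoD)
  have g_nonneg: "?g x \<ge> 0" for x
    using mono[of 0 "x \<bullet> p"] mono[of "x \<bullet> p" 0]
    by (cases "x \<bullet> p \<ge> 0") (auto intro: mult_nonneg_nonneg mult_nonpos_nonpos)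
  have int1: "integrable std_gauss (\<lambda>x. f (x \<bullet> p) * (x \<bullet> p))"
    using integrable_inner_left[OF int, of p] by simp
  have int2: "integrable std_gauss (\<lambda>x. f 0 * (x \<bullet> p))"
    by (intro integrable_mult_right integrable_inner_left integrable_std_gauss)
  have "(LINT x|std_gauss. x \<bullet> p) = 0"
    using integral_inner_left[OF integrable_std_gauss, of p] by (simp add: integral_std_gauss)
  then have Vp: "V \<bullet> p = (LINT x|std_gauss. ?g x)"
    using int1 int2 by (simp add: V left_diff_distrib)
  have int_g: "integrable std_gauss ?g"
    using Bochner_Integration.integrable_diff[OF int1 int2] by (simp add: left_diff_distrib)
  have "V \<bullet> p \<noteq> 0"
  proof
    assume "V \<bullet> p = 0"
    then have AE0: "AE x in std_gauss. ?g x = 0"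
      using integral_nonneg_eq_0_iff_AE[OF int_g] g_nonneg Vp by simp
    obtain t where t: "f t \<noteq> f 0"
      using nonconst by (auto simp: constant_on_def)
    \<comment> \<open>The half-space beyond \<open>t\<close>, seen from 0. By monotonicity
      \<open>f\<close> stays at least as far from \<open>f 0\<close> there as it is at
      \<open>t\<close>, so the integrand does not vanish on \<open>U\<close>.\<close>
    define U where "U = (if t > 0 then {x. t < x \<bullet> p} else {x. x \<bullet> p < t})"
    have "open U"
      by (auto simp: U_def intro!: open_Collect_less continuous_intros)
    have "((if t > 0 then t + 1 else t - 1) / (p \<bullet> p)) *\<^sub>R p \<in> U"
      using pp by (auto simp: U_def)
    then have "U \<noteq> {}"
      by blast
    have "?g x \<noteq> 0" if "x \<in> U" for x
    proof (cases "t > 0")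
      case True
      then show ?thesis
        using that t mono[of t "x \<bullet> p"] mono[of 0 t] by (simp add: U_def)
    next
      case False
      then have "x \<bullet> p < t" "t \<le> 0"
        using that by (simp_all add: U_def)
      then show ?thesis
        using t mono[of "x \<bullet> p" t] mono[of t 0] by simp
    qed
    with AE0 have "AE x in std_gauss. x \<notin> U"
      by (auto elim!: eventually_mono)
    then have "emeasure std_gauss U = 0"
      using \<open>open U\<close> by (simp add: AE_iff_measurable[OF _ refl])
    then show False
      using emeasure_std_gauss_pos[OF \<open>open U\<close> \<open>U \<noteq> {}\<close>] by simp
  qed
  moreover have "V \<bullet> p \<ge> 0"
    unfolding Vp using g_nonneg by (intro integral_nonneg_AE) auto
  ultimately have "c > 0"
    using pp by (simp add: c_def)
  then show ?thesis
    unfolding V_def[symmetric] V_eq by (intro exI[of _ c]) simp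
qed

text \<open>The half-space \<open>u < x \<bullet> p\<close> is open and nonempty, so an almost sure
  property of the projection holds somewhere in it. Since \<open>u\<close> is arbitrary, such points
  exist arbitrarily far to the right, which suffices to bound a monotone function
  everywhere.\<close>

lemma std_gauss_AE_ridge:
  fixes p :: "real ^ 'd"
  assumes "p \<noteq> 0" and AE: "AE x in std_gauss. Q (x \<bullet> p)"
  shows "\<exists>r>u. Q r"
proof (rule ccontr)
  assume neg: "\<not> (\<exists>r>u. Q r)"
  let ?U = "{x. u < x \<bullet> p}"
  have "open ?U"
    by (intro open_Collect_less continuous_intros)
  have "AE x in std_gauss. x \<notin> ?U"
    using AE neg by (auto elim!: eventually_mono)
  then have "emeasure std_gauss ?U = 0"
    using \<open>open ?U\<close> by (simp add: AE_iff_measurable[OF _ refl])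
  moreover have "((u + 1) / (p \<bullet> p)) *\<^sub>R p \<in> ?U"
    using \<open>p \<noteq> 0\<close> by simp
  ultimately show False
    using emeasure_std_gauss_pos[OF \<open>open ?U\<close>] by blast
qed

text \<open>If the mass were 0, \<open>f\<close> would vanish at arbitrarily large arguments; being
  monotone and nonnegative, it would then vanish identically and be constant.\<close>

lemma std_gauss_ridge_mass_pos:
  fixes p :: "real ^ 'd" and f :: "real \<Rightarrow> real"
  assumes "p \<noteq> 0" "mono f" and nonneg: "\<And>u. 0 \<le> f u" and le1: "\<And>u. f u \<le> 1"
    and nonconst: "\<not> f constant_on UNIV"
  shows "(LINT x|std_gauss. f (x \<bullet> p)) > 0"
proof -
  interpret prob_space "std_gauss :: (real ^ 'd) measure"
    by (rule prob_space_std_gauss)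
  have [measurable]: "f \<in> borel_measurable borel"
    using \<open>mono f\<close> by (rule borel_measurable_mono)
  have int: "integrable std_gauss (\<lambda>x. f (x \<bullet> p))"
    by (rule integrable_const_bound[where B = 1]) (simp_all add: nonneg le1)
  have "(LINT x|std_gauss. f (x \<bullet> p)) \<noteq> 0"
  proof
    assume "(LINT x|std_gauss. f (x \<bullet> p)) = 0"
    then have "AE x in std_gauss. f (x \<bullet> p) = 0"
      using integral_nonneg_eq_0_iff_AE[OF int] nonneg by simp
    then have "\<exists>r>u. f r = 0" for u
      using std_gauss_AE_ridge[OF \<open>p \<noteq> 0\<close>, of "\<lambda>r. f r = 0"] by blast
    then have "f u = 0" for u
      using monoD[OF \<open>mono f\<close>, of u] nonneg[of u] by (metis antisym less_imp_le)
    then show False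
      using nonconst by (auto simp: constant_on_def)
  qed
  moreover have "(LINT x|std_gauss. f (x \<bullet> p)) \<ge> 0"
    by (intro integral_nonneg_AE) (simp add: nonneg)
  ultimately show ?thesis
    by simp
qed

subsection \<open>The data distribution\<close>

text \<open>Only a subprobability can be claimed, since for \<theta> = 0 the kernel is the null
  measure. That case has to be covered because the training mean is not assumed, but proved, to be
  nonzero.\<close>

lemma data_dist_kernel:
  "distr (isotropic_normal (y *\<^sub>R \<theta>) (norm \<theta> / \<rho>)) (borel \<Otimes>\<^sub>M borel) (\<lambda>x. (x, y))
     \<in> space (subprob_algebra (borel \<Otimes>\<^sub>M (borel :: real measure)))"
  if "\<rho> > 0" for \<theta> :: "real ^ 'd"
proof -
  have "subprob_space (isotropic_normal (y *\<^sub>R \<theta>) (norm \<theta> / \<rho>))"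
  proof (cases "\<theta> = 0")
    case True
    then show ?thesis
      by (auto simp: isotropic_normal_0 intro!: subprob_spaceI)
  next
    case False
    then show ?thesis
      using that by (intro prob_space_imp_subprob_space prob_space_isotropic_normal) simp
  qed
  then show ?thesis
    by (auto simp: space_subprob_algebra space_pair_measure intro!: subprob_space.subprob_space_distr)
qed

lemma sets_data_dist [simp, measurable_cong]:
  "\<rho> > 0 \<Longrightarrow> sets (data_dist \<theta> \<rho>) = sets (borel \<Otimes>\<^sub>M borel)"
  unfolding data_dist_def by (rule sets_bind) simp_all

lemma data_dist_0_not_prob_space:
  assumes "\<rho> > 0"
  shows "\<not> prob_space (data_dist (0 :: real ^ 'd) \<rho>)"
proof
  let ?D = "data_dist (0 :: real ^ 'd) \<rho>"
  have UNIV_sets: "UNIV \<in> sets (borel \<Otimes>\<^sub>M borel :: ((real ^ 'd) \<times> real) measure)"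
    using sets.top[of "borel \<Otimes>\<^sub>M borel :: ((real ^ 'd) \<times> real) measure"]
    by (simp add: space_pair_measure)
  assume "prob_space ?D"
  then have "emeasure ?D (space ?D) = 1"
    by (rule prob_space.emeasure_space_1)
  also have "space ?D = UNIV"
    using sets_eq_imp_space_eq[OF sets_data_dist[OF assms]] by (simp add: space_pair_measure)
  also have "emeasure ?D UNIV = 0"
    unfolding data_dist_def
    using data_dist_kernel[OF assms, of _ "0 :: real ^ 'd"] UNIV_sets
    by (subst emeasure_bind[where N = "borel \<Otimes>\<^sub>M borel"])
       (simp_all add: emeasure_distr isotropic_normal_0)
  finally show False
    by simp
qed

lemma isotropic_normal_uminus:
  assumes "s > 0"
  shows "distr (isotropic_normal (- \<theta>) s) borel uminus = isotropic_normal (\<theta> :: real ^ 'd) s"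
proof -
  have "distr (isotropic_normal (- \<theta>) s) borel uminus =
      distr (distr std_gauss borel uminus) borel (\<lambda>x. \<theta> + s *\<^sub>R x)"
    using assms by (simp add: isotropic_normal_affine[of s "- \<theta>"] distr_distr comp_def)
  also have "distr std_gauss borel uminus = (std_gauss :: (real ^ 'd) measure)"
    by (rule isotropic_normal_orthogonal) (simp_all add: orthogonal_transformation_def linear_iff)
  finally show ?thesis
    using assms by (simp add: isotropic_normal_affine[of s \<theta>])
qed

text \<open>Given the label \<open>y\<close>, the signed point has mean y^2 \<theta> = \<theta>, and
  the centred normal law is symmetric. So both labels yield the same law, and the mixture averages a
  constant kernel.\<close>

lemma data_dist_signed:
  fixes \<theta> :: "real ^ 'd"
  assumes "\<theta> \<noteq> 0" "\<rho> > 0"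
  shows "distr (data_dist \<theta> \<rho>) borel (\<lambda>(x, y). y *\<^sub>R x) = isotropic_normal \<theta> (norm \<theta> / \<rho>)"
proof -
  let ?s = "norm \<theta> / \<rho>"
  have s: "?s > 0"
    using assms by simp
  have "distr (data_dist \<theta> \<rho>) borel (\<lambda>(x, y). y *\<^sub>R x) =
      measure_pmf (pmf_of_set {-1, 1}) \<bind> (\<lambda>y. distr (distr (isotropic_normal (y *\<^sub>R \<theta>) ?s)
        (borel \<Otimes>\<^sub>M borel) (\<lambda>x. (x, y))) borel (\<lambda>(x, y). y *\<^sub>R x))"
    unfolding data_dist_def using assms
    by (intro distr_bind[where K = "borel \<Otimes>\<^sub>M borel"]) (auto intro!: data_dist_kernel)
  also have "\<dots> = measure_pmf (pmf_of_set {-1, 1}) \<bind> (\<lambda>y. distr (isotropic_normal (y *\<^sub>R \<theta>) ?s)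
        borel (\<lambda>x. y *\<^sub>R x))"
    by (simp add: distr_distr comp_def)
  also have "\<dots> = measure_pmf (pmf_of_set {-1, 1 :: real}) \<bind> (\<lambda>_. isotropic_normal \<theta> ?s)"
  proof (rule bind_measure_pmf_cong)
    show "distr (isotropic_normal (y *\<^sub>R \<theta>) ?s) borel ((*\<^sub>R) y) \<in> space (subprob_algebra borel)"
      "isotropic_normal \<theta> ?s \<in> space (subprob_algebra borel)" for y
      using s by (auto simp: space_subprob_algebra intro!: prob_space_imp_subprob_space
          prob_space_isotropic_normal prob_space.prob_space_distr)
    show "distr (isotropic_normal (y *\<^sub>R \<theta>) ?s) borel ((*\<^sub>R) y) = isotropic_normal \<theta> ?s"
      if "y \<in> set_pmf (pmf_of_set {- 1, 1})" for y
    proof -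
      have "(*\<^sub>R) 1 = (\<lambda>x :: real ^ 'd. x)" "(*\<^sub>R) (- 1) = (uminus :: real ^ 'd \<Rightarrow> _)"
        by auto
      then show ?thesis
        using that isotropic_normal_uminus[OF s, of \<theta>] distr_id2[of borel "isotropic_normal \<theta> ?s"]
        by auto
    qed
  qed
  also have "\<dots> = isotropic_normal \<theta> ?s"
    using s by (intro bind_const' measure_pmf.prob_space_axioms prob_space_imp_subprob_space
        prob_space_isotropic_normal)
  finally show ?thesis .
qed

text \<open>Standardising the signed point turns correct classification into a half-space. Since
  \<open>x \<bullet> w\<close> has standard deviation \<open>norm w\<close>, the value is the
  standard normal distribution function at \<open>cosine \<theta> w * \<rho>\<close>, hence monotone
  in that product.\<close>

lemma accuracy_data_dist:
  fixes \<theta> w :: "real ^ 'd"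
  assumes "\<theta> \<noteq> 0" "\<rho> > 0" "w \<noteq> 0"
  shows "accuracy (data_dist \<theta> \<rho>) w =
    measure std_gauss {x. - (cosine \<theta> w * \<rho> * norm w) < x \<bullet> w}"
proof -
  let ?s = "norm \<theta> / \<rho>"
  have s: "?s > 0"
    using assms by simp
  have sp: "space (data_dist \<theta> \<rho>) = UNIV"
    using sets_eq_imp_space_eq[OF sets_data_dist[OF assms(2)]] by (simp add: space_pair_measure)
  have "accuracy (data_dist \<theta> \<rho>) w =
      measure (distr (data_dist \<theta> \<rho>) borel (\<lambda>(x, y). y *\<^sub>R x)) {z. 0 < z \<bullet> w}"
    using assms unfolding accuracy_def
    by (subst measure_distr) (auto simp: sp intro!: arg_cong[where f = "measure _"])
  also have "\<dots> = measure std_gauss {x. 0 < (\<theta> + ?s *\<^sub>R x) \<bullet> w}"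
    unfolding data_dist_signed[OF assms(1,2)] isotropic_normal_affine[OF s]
    by (subst measure_distr) auto
  also have "{x. 0 < (\<theta> + ?s *\<^sub>R x) \<bullet> w} = {x. - (cosine \<theta> w * \<rho> * norm w) < x \<bullet> w}"
    using assms by (auto simp: cosine_def inner_add_left field_simps)
  finally show ?thesis .
qed

lemma accuracy_mono:
  fixes \<theta> \<theta>' w :: "real ^ 'd"
  assumes "\<theta> \<noteq> 0" "\<rho> > 0" "\<theta>' \<noteq> 0" "\<rho>' > 0" "w \<noteq> 0"
    and le: "cosine \<theta> w * \<rho> \<le> cosine \<theta>' w * \<rho>'"
  shows "accuracy (data_dist \<theta> \<rho>) w \<le> accuracy (data_dist \<theta>' \<rho>') w"
proof -
  interpret prob_space "std_gauss :: (real ^ 'd) measure"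
    by (rule prob_space_std_gauss)
  have "cosine \<theta> w * \<rho> * norm w \<le> cosine \<theta>' w * \<rho>' * norm w"
    using le by (rule mult_right_mono) simp
  then show ?thesis
    unfolding accuracy_data_dist[OF assms(1,2,5)] accuracy_data_dist[OF assms(3,4,5)]
    by (intro finite_measure_mono) auto
qed

subsection \<open>Averages over a random subset\<close>

text \<open>If point \<open>i\<close> is kept, dividing by the number of kept points is multiplying
  by \<open>R i\<close>, which depends only on the other points and so is independent of the pair of
  \<open>Z i\<close> and \<open>K i\<close>. Hence the average has expectation
  \<open>S *\<^sub>R V\<close>, and some point is kept with probability \<open>S * \<pi>\<close>,
  with the same \<open>S\<close>; it cancels in the quotient and is never evaluated.\<close>

lemma (in prob_space) integral_thinned_average:
  fixes Z :: "nat \<Rightarrow> 'a \<Rightarrow> 'b::euclidean_space" and K :: "nat \<Rightarrow> 'a \<Rightarrow> bool"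
  assumes ind: "indep_vars (\<lambda>_. borel \<Otimes>\<^sub>M count_space UNIV) (\<lambda>i \<omega>. (Z i \<omega>, K i \<omega>)) {..<n}"
    and int: "\<And>i. i < n \<Longrightarrow> integrable M (Z i)"
    and V: "\<And>i. i < n \<Longrightarrow> (LINT \<omega>|M. of_bool (K i \<omega>) *\<^sub>R Z i \<omega>) = V"
    and \<pi>: "\<And>i. i < n \<Longrightarrow> (LINT \<omega>|M. of_bool (K i \<omega>)) = \<pi>"
    and "n \<ge> 1" "\<pi> > 0"
  shows "(LINT \<omega>|uniform_measure M {\<omega> \<in> space M. \<exists>i<n. K i \<omega>}.
      (1 / real (card {i. i < n \<and> K i \<omega>})) *\<^sub>R (\<Sum>i | i < n \<and> K i \<omega>. Z i \<omega>)) = (1 / \<pi>) *\<^sub>R V"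
proof -
  define R :: "nat \<Rightarrow> 'a \<Rightarrow> real" where
    "R i \<omega> = 1 / (1 + (\<Sum>j\<in>{..<n} - {i}. of_bool (K j \<omega>)))" for i \<omega>
  define A where "A = {\<omega> \<in> space M. \<exists>i<n. K i \<omega>}"
  define F where "F \<omega> = (1 / real (card {i. i < n \<and> K i \<omega>})) *\<^sub>R (\<Sum>i | i < n \<and> K i \<omega>. Z i \<omega>)" for \<omega>
  have rv: "(\<lambda>\<omega>. (Z i \<omega>, K i \<omega>)) \<in> measurable M (borel \<Otimes>\<^sub>M count_space UNIV)" if "i < n" for i
    using ind that by (auto simp: indep_vars_def)
  have K_meas: "K i \<in> measurable M (count_space UNIV)" if "i < n" for i
    using measurable_compose[OF rv[OF that] measurable_snd] by simp
  have K_real [measurable]: "(\<lambda>\<omega>. of_bool (K i \<omega>) :: real) \<in> borel_measurable M" if "i < n" for i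
    using K_meas[OF that] by measurable
  have Z_meas [measurable]: "Z i \<in> borel_measurable M" if "i < n" for i
    using int[OF that] by auto
  have R_meas [measurable]: "R i \<in> borel_measurable M" for i
    unfolding R_def by measurable (auto intro: K_meas)
  have R_bounds: "0 \<le> R i \<omega>" "R i \<omega> \<le> 1" for i \<omega>
    by (auto simp: R_def divide_le_eq sum_nonneg)
  have A_meas [measurable]: "A \<in> sets M"
  proof -
    have A_UN: "A = (\<Union>i\<in>{..<n}. K i -` {True} \<inter> space M)"
      by (auto simp: A_def)
    show ?thesis
      unfolding A_UN by (intro sets.finite_UN measurable_sets[OF K_meas]) auto
  qed
  have card_eq: "R i \<omega> = 1 / real (card {i. i < n \<and> K i \<omega>})" if "i < n" "K i \<omega>" for i \<omega>
  proof -
    have "{j. j < n \<and> K j \<omega>} = insert i {j \<in> {..<n} - {i}. K j \<omega>}"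
      using that by auto
    then have "real (card {j. j < n \<and> K j \<omega>}) = 1 + (\<Sum>j\<in>{..<n} - {i}. of_bool (K j \<omega>))"
      by (simp add: sum.inter_filter[symmetric] of_bool_def[abs_def])
    then show ?thesis
      by (simp add: R_def)
  qed
  have F_eq: "F \<omega> = (\<Sum>i<n. R i \<omega> *\<^sub>R of_bool (K i \<omega>) *\<^sub>R Z i \<omega>)" for \<omega>
  proof -
    have "F \<omega> = (\<Sum>i\<in>{i \<in> {..<n}. K i \<omega>}. R i \<omega> *\<^sub>R Z i \<omega>)"
      unfolding F_def by (auto simp: scaleR_sum_right card_eq intro!: sum.cong)
    also have "\<dots> = (\<Sum>i<n. if K i \<omega> then R i \<omega> *\<^sub>R Z i \<omega> else 0)"
      by (rule sum.inter_filter) simp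
    finally show ?thesis
      by (auto intro!: sum.cong)
  qed
  \<comment> \<open>If m > 0 points are kept, each contributes 1/m; if none is kept, the sum is
    empty.\<close>
  have A_eq: "indicator A \<omega> = (\<Sum>i<n. R i \<omega> * of_bool (K i \<omega>))" if "\<omega> \<in> space M" for \<omega>
  proof -
    have "(\<Sum>i<n. R i \<omega> * of_bool (K i \<omega>)) = (\<Sum>i<n. if K i \<omega> then R i \<omega> else 0)"
      by (rule sum.cong) auto
    also have "\<dots> = (\<Sum>i\<in>{i \<in> {..<n}. K i \<omega>}. R i \<omega>)"
      by (rule sum.inter_filter[symmetric]) simp
    also have "\<dots> = (\<Sum>i\<in>{i \<in> {..<n}. K i \<omega>}. 1 / real (card {i. i < n \<and> K i \<omega>}))"
      by (auto simp: card_eq intro!: sum.cong)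
    also have "\<dots> = indicator A \<omega>"
      using that by (auto simp: A_def indicator_def card_eq_0_iff)
    finally show ?thesis ..
  qed
  have int_R: "integrable M (R i)" for i
    by (rule integrable_const_bound[where B = 1]) (use R_bounds in auto)
  \<comment> \<open>On the event that point i is kept, the number of points kept is a function of the other points.\<close>
  have indep: "(LINT \<omega>|M. R i \<omega> * g (Z i \<omega>, K i \<omega>)) = (LINT \<omega>|M. R i \<omega>) * (LINT \<omega>|M. g (Z i \<omega>, K i \<omega>))"
    if i: "i < n" and g: "g \<in> borel_measurable (borel \<Otimes>\<^sub>M count_space UNIV)"
      and int_g: "integrable M (\<lambda>\<omega>. g (Z i \<omega>, K i \<omega>))" for i g
  proof (rule indep_var_lebesgue_integral)
    let ?N = "borel \<Otimes>\<^sub>M count_space UNIV :: ('b \<times> bool) measure"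
    let ?J = "{..<n} - {i}"
    define r :: "(nat \<Rightarrow> 'b \<times> bool) \<Rightarrow> real" where
      "r w = 1 / (1 + (\<Sum>j\<in>?J. of_bool (snd (w j))))" for w
    have "indep_var (PiM ?J (\<lambda>_. ?N)) (\<lambda>\<omega>. restrict (\<lambda>i. (Z i \<omega>, K i \<omega>)) ?J)
        (PiM {i} (\<lambda>_. ?N)) (\<lambda>\<omega>. restrict (\<lambda>i. (Z i \<omega>, K i \<omega>)) {i})"
      using i by (intro indep_var_restrict[OF ind]) auto
    then have "indep_var borel (r \<circ> (\<lambda>\<omega>. restrict (\<lambda>i. (Z i \<omega>, K i \<omega>)) ?J))
        borel ((\<lambda>w. g (w i)) \<circ> (\<lambda>\<omega>. restrict (\<lambda>i. (Z i \<omega>, K i \<omega>)) {i}))"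
    proof (rule indep_var_compose)
      have "(\<lambda>w. of_bool (snd (w j)) :: real) \<in> borel_measurable (PiM ?J (\<lambda>_. ?N))" if "j \<in> ?J" for j
      proof -
        have "(\<lambda>w. snd (w j)) \<in> measurable (PiM ?J (\<lambda>_. ?N)) (count_space UNIV)"
          by (rule measurable_compose[OF _ measurable_snd]) (rule measurable_component_singleton[OF that])
        then show ?thesis
          by measurable
      qed
      then show "r \<in> borel_measurable (PiM ?J (\<lambda>_. ?N))"
        unfolding r_def by measurable
      show "(\<lambda>w. g (w i)) \<in> borel_measurable (PiM {i} (\<lambda>_. ?N))"
        by (rule measurable_compose[OF _ g]) (rule measurable_component_singleton, simp)
    qed
    moreover have "r \<circ> (\<lambda>\<omega>. restrict (\<lambda>i. (Z i \<omega>, K i \<omega>)) ?J) = R i"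
      by (auto simp: r_def R_def fun_eq_iff intro!: sum.cong)
    moreover have "(\<lambda>w. g (w i)) \<circ> (\<lambda>\<omega>. restrict (\<lambda>i. (Z i \<omega>, K i \<omega>)) {i}) = (\<lambda>\<omega>. g (Z i \<omega>, K i \<omega>))"
      by auto
    ultimately show "indep_var borel (R i) borel (\<lambda>\<omega>. g (Z i \<omega>, K i \<omega>))"
      by simp
  qed (fact int_R int_g)+
  define S where "S = (\<Sum>i<n. (LINT \<omega>|M. R i \<omega>))"
  have int_K: "integrable M (\<lambda>\<omega>. of_bool (K i \<omega>) :: real)" if "i < n" for i
    using that by (intro integrable_const_bound[where B = 1]) auto
  have int_KZ: "integrable M (\<lambda>\<omega>. of_bool (K i \<omega>) *\<^sub>R Z i \<omega>)" if "i < n" for i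
    using that by (intro Bochner_Integration.integrable_bound[OF int[OF that]]) auto
  have int_RK: "integrable M (\<lambda>\<omega>. R i \<omega> * of_bool (K i \<omega>))" if "i < n" for i
    using that R_bounds
    by (intro Bochner_Integration.integrable_bound[OF int_K[OF that]]) auto
  have int_RKZ: "integrable M (\<lambda>\<omega>. R i \<omega> *\<^sub>R of_bool (K i \<omega>) *\<^sub>R Z i \<omega>)" if "i < n" for i
  proof (rule Bochner_Integration.integrable_bound[OF int[OF that]])
    show "AE \<omega> in M. norm (R i \<omega> *\<^sub>R of_bool (K i \<omega>) *\<^sub>R Z i \<omega>) \<le> norm (Z i \<omega>)"
      using R_bounds by (auto intro!: mult_left_le_one_le)
  qed (use that in measurable)
  have "prob A = (LINT \<omega>|M. indicator A \<omega>)"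
    by simp
  also have "\<dots> = (LINT \<omega>|M. (\<Sum>i<n. R i \<omega> * of_bool (K i \<omega>)))"
    by (rule Bochner_Integration.integral_cong) (simp_all add: A_eq)
  also have "\<dots> = (\<Sum>i<n. (LINT \<omega>|M. R i \<omega> * of_bool (K i \<omega>)))"
    using int_RK by (intro Bochner_Integration.integral_sum) simp
  also have "\<dots> = (\<Sum>i<n. (LINT \<omega>|M. R i \<omega>) * \<pi>)"
  proof (rule sum.cong)
    fix i assume "i \<in> {..<n}"
    then show "(LINT \<omega>|M. R i \<omega> * of_bool (K i \<omega>)) = (LINT \<omega>|M. R i \<omega>) * \<pi>"
      using indep[of i "\<lambda>(z, k). of_bool k"] int_K \<pi> by simp
  qed simp
  finally have prob_A: "prob A = S * \<pi>"
    by (simp add: S_def sum_distrib_right)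
  \<comment> \<open>Index 0 exists because \<open>n \<ge> 1\<close>. The bound makes the
    conditioning event non-null and, through \<open>prob A = S * \<pi>\<close>, excludes
    \<open>S = 0\<close>.\<close>
  have "\<pi> \<le> prob A"
  proof -
    have "\<pi> = (LINT \<omega>|M. of_bool (K 0 \<omega>))"
      using \<pi>[of 0] \<open>n \<ge> 1\<close> by simp
    also have "\<dots> \<le> (LINT \<omega>|M. indicator A \<omega>)"
    proof (rule integral_mono)
      show "integrable M (\<lambda>\<omega>. indicator A \<omega> :: real)"
        by (rule integrable_const_bound[where B = 1]) auto
      show "of_bool (K 0 \<omega>) \<le> (indicator A \<omega> :: real)" if "\<omega> \<in> space M" for \<omega>
        using that \<open>n \<ge> 1\<close> by (auto simp: A_def indicator_def intro!: exI[of _ 0])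
    qed (use \<open>n \<ge> 1\<close> int_K in simp)
    finally show ?thesis
      by simp
  qed
  then have pos: "prob A > 0"
    using \<open>\<pi> > 0\<close> by simp
  then have "S \<noteq> 0"
    using prob_A by auto
  have int_F: "integrable M F"
    unfolding F_eq[abs_def] using int_RKZ by (intro Bochner_Integration.integrable_sum) simp
  have "(LINT \<omega>|M. F \<omega>) = S *\<^sub>R V"
  \<comment> \<open>The product rule for independent variables concerns scalars, so it is applied in
    each coordinate.\<close>
  proof (rule euclidean_eqI)
    fix b :: 'b
    have "(LINT \<omega>|M. F \<omega>) \<bullet> b = (LINT \<omega>|M. F \<omega> \<bullet> b)"
      using int_F by simp
    also have "\<dots> = (LINT \<omega>|M. (\<Sum>i<n. R i \<omega> * (of_bool (K i \<omega>) * (Z i \<omega> \<bullet> b))))"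
      by (simp add: F_eq inner_sum_left mult.assoc)
    also have "\<dots> = (\<Sum>i<n. (LINT \<omega>|M. R i \<omega> * (of_bool (K i \<omega>) * (Z i \<omega> \<bullet> b))))"
    proof (rule Bochner_Integration.integral_sum)
      fix i assume "i \<in> {..<n}"
      then have "integrable M (\<lambda>\<omega>. R i \<omega> *\<^sub>R of_bool (K i \<omega>) *\<^sub>R Z i \<omega>)"
        by (intro int_RKZ) simp
      from integrable_inner_left[OF this, of b]
      show "integrable M (\<lambda>\<omega>. R i \<omega> * (of_bool (K i \<omega>) * (Z i \<omega> \<bullet> b)))"
        by (simp add: mult.assoc)
    qed
    also have "\<dots> = (\<Sum>i<n. (LINT \<omega>|M. R i \<omega>) * (V \<bullet> b))"
    proof (rule sum.cong)
      fix i assume "i \<in> {..<n}"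
      then have i: "i < n"
        by simp
      have "V \<bullet> b = (LINT \<omega>|M. of_bool (K i \<omega>) * (Z i \<omega> \<bullet> b))"
        using integral_inner_left[OF int_KZ[OF i], of b] V[OF i] by simp
      moreover have "(\<lambda>(z, k). of_bool k * (z \<bullet> b)) \<in> borel_measurable (borel \<Otimes>\<^sub>M count_space UNIV)"
        by measurable
      ultimately show "(LINT \<omega>|M. R i \<omega> * (of_bool (K i \<omega>) * (Z i \<omega> \<bullet> b))) = (LINT \<omega>|M. R i \<omega>) * (V \<bullet> b)"
        using indep[of i "\<lambda>(z, k). of_bool k * (z \<bullet> b)"] integrable_inner_left[OF int_KZ[OF i], of b] i
        by simp
    qed simp
    finally show "(LINT \<omega>|M. F \<omega>) \<bullet> b = (S *\<^sub>R V) \<bullet> b"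
      by (simp add: S_def sum_distrib_right)
  qed
  have dens: "uniform_measure M A = density M (\<lambda>\<omega>. ennreal (indicator A \<omega> / prob A))"
    unfolding uniform_measure_def using pos
    by (intro density_cong)
       (auto simp: emeasure_eq_measure divide_ennreal[symmetric] ennreal_indicator)
  have F0: "(indicator A \<omega> / prob A) *\<^sub>R F \<omega> = (1 / prob A) *\<^sub>R F \<omega>" if "\<omega> \<in> space M" for \<omega>
    using that by (cases "\<omega> \<in> A") (auto simp: A_def F_def)
  have "(LINT \<omega>|uniform_measure M A. F \<omega>) = (LINT \<omega>|M. (indicator A \<omega> / prob A) *\<^sub>R F \<omega>)"
    unfolding dens using int_F by (intro integral_density) (auto simp: indicator_def)
  also have "\<dots> = (LINT \<omega>|M. (1 / prob A) *\<^sub>R F \<omega>)"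
    by (rule Bochner_Integration.integral_cong) (simp_all only: F0)
  also have "\<dots> = (1 / prob A) *\<^sub>R S *\<^sub>R V"
    by (simp only: integral_scaleR_right \<open>(LINT \<omega>|M. F \<omega>) = S *\<^sub>R V\<close>)
  also have "\<dots> = (1 / \<pi>) *\<^sub>R V"
    using \<open>S \<noteq> 0\<close> by (simp add: prob_A)
  finally show ?thesis
    unfolding F_def A_def .
qed

text \<open>The conditional expectation of an indicator is at most 1. Testing it against a function
  of \<open>U\<close>, which is measurable for the conditioning algebra, lets
  \<open>q (U \<omega>)\<close> replace the indicator of \<open>K\<close> under the
  integral.\<close>

lemma (in prob_space)
  fixes K :: "'a \<Rightarrow> bool" and q g :: "'c \<Rightarrow> real"
  assumes U [measurable]: "U \<in> measurable M N" and K [measurable]: "K \<in> measurable M (count_space UNIV)"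
    and q: "AE \<omega> in M. real_cond_exp M (vimage_algebra (space M) U N)
      (indicator {\<omega> \<in> space M. K \<omega>}) \<omega> = q (U \<omega>)"
    and q_meas [measurable]: "q \<in> borel_measurable N"
  shows cond_prob_le_1: "AE \<omega> in M. q (U \<omega>) \<le> 1"
    and integral_cond_prob: "g \<in> borel_measurable N \<Longrightarrow> integrable M (\<lambda>\<omega>. g (U \<omega>)) \<Longrightarrow>
      (LINT \<omega>|M. of_bool (K \<omega>) * g (U \<omega>)) = (LINT \<omega>|M. q (U \<omega>) * g (U \<omega>))"
proof -
  let ?F = "vimage_algebra (space M) U N"
  let ?I = "indicator {\<omega> \<in> space M. K \<omega>} :: 'a \<Rightarrow> real"
  have "sets ?F \<subseteq> sets M"
    by (rule sets_image_in_sets) (use U in auto)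
  then interpret finite_measure_subalgebra M ?F
    by unfold_locales (simp add: subalgebra_def)
  have I_meas [measurable]: "?I \<in> borel_measurable M"
    by measurable
  have int_I: "integrable M ?I"
    by (rule integrable_const_bound[where B = 1]) (auto simp: indicator_def)
  have "AE \<omega> in M. real_cond_exp M ?F ?I \<omega> \<le> 1"
    by (rule real_cond_exp_le_c[OF int_I]) (auto simp: indicator_def)
  with q show "AE \<omega> in M. q (U \<omega>) \<le> 1"
    by eventually_elim simp
  assume g [measurable]: "g \<in> borel_measurable N" and int: "integrable M (\<lambda>\<omega>. g (U \<omega>))"
  have "(\<lambda>\<omega>. g (U \<omega>)) \<in> borel_measurable ?F"
    by (rule measurable_compose[OF measurable_vimage_algebra1 g]) (use measurable_space[OF U] in auto)
  moreover have "integrable M (\<lambda>\<omega>. g (U \<omega>) * ?I \<omega>)"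
    by (rule Bochner_Integration.integrable_bound[OF int]) (auto simp: indicator_def)
  ultimately have "(LINT \<omega>|M. g (U \<omega>) * real_cond_exp M ?F ?I \<omega>) = (LINT \<omega>|M. g (U \<omega>) * ?I \<omega>)"
    by (intro real_cond_exp_intg) auto
  moreover have "(LINT \<omega>|M. g (U \<omega>) * real_cond_exp M ?F ?I \<omega>) = (LINT \<omega>|M. q (U \<omega>) * g (U \<omega>))"
    using q by (intro integral_cong_AE) (auto elim!: eventually_mono)
  moreover have "(LINT \<omega>|M. g (U \<omega>) * ?I \<omega>) = (LINT \<omega>|M. of_bool (K \<omega>) * g (U \<omega>))"
    by (rule Bochner_Integration.integral_cong) (auto simp: indicator_def)
  ultimately show "(LINT \<omega>|M. of_bool (K \<omega>) * g (U \<omega>)) = (LINT \<omega>|M. q (U \<omega>) * g (U \<omega>))"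
    by simp
qed

subsection \<open>Slopes\<close>

lemma slope_eq:
  fixes \<theta> :: "real ^ 'd"
  assumes "\<theta> \<noteq> 0"
  shows "slope \<theta>ID \<rho>ID \<theta>OOD \<rho>OOD \<theta> =
    (norm \<theta>ID * \<rho>OOD) / (norm \<theta>OOD * \<rho>ID) * ((\<theta>OOD \<bullet> \<theta>) / (\<theta>ID \<bullet> \<theta>))"
  using assms by (simp add: slope_def cosine_def mult_ac)

lemma slope_zero_OOD: "slope \<theta>ID \<rho>ID 0 \<rho>OOD \<theta> = 0"
  by (simp add: slope_def cosine_def)

lemma slope_add_between:
  fixes u p :: "real ^ 'd"
  assumes "\<rho>ID > 0" "\<rho>OOD > 0" "c > 0" and pos: "cosine \<theta>ID u > 0" "cosine \<theta>ID p > 0"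
    and less: "slope \<theta>ID \<rho>ID \<theta>OOD \<rho>OOD u < slope \<theta>ID \<rho>ID \<theta>OOD \<rho>OOD p"
  shows "slope \<theta>ID \<rho>ID \<theta>OOD \<rho>OOD u < slope \<theta>ID \<rho>ID \<theta>OOD \<rho>OOD (u + c *\<^sub>R p)"
    and "slope \<theta>ID \<rho>ID \<theta>OOD \<rho>OOD (u + c *\<^sub>R p) < slope \<theta>ID \<rho>ID \<theta>OOD \<rho>OOD p"
proof -
  \<comment> \<open>A cosine with a zero vector is 0 by the convention on division, and with
    \<open>\<theta>OOD = 0\<close> all slopes would be 0, against the strict inequality
    \<open>less\<close>.\<close>
  have nz: "u \<noteq> 0" "p \<noteq> 0" "\<theta>ID \<noteq> 0" "\<theta>OOD \<noteq> 0"
    using pos less slope_zero_OOD[of \<theta>ID \<rho>ID \<rho>OOD] by (auto simp: cosine_def)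
  define C where "C = (norm \<theta>ID * \<rho>OOD) / (norm \<theta>OOD * \<rho>ID)"
  have C: "C > 0"
    using assms nz by (simp add: C_def)
  define a where "a = \<theta>ID \<bullet> u"
  define b where "b = \<theta>ID \<bullet> p"
  define a' where "a' = \<theta>OOD \<bullet> u"
  define b' where "b' = \<theta>OOD \<bullet> p"
  have ab: "a > 0" "b > 0"
    using pos nz by (simp_all add: cosine_def a_def b_def zero_less_divide_iff mult_less_0_iff)
  have "\<theta>ID \<bullet> (u + c *\<^sub>R p) = a + c * b"
    by (simp add: inner_add_right a_def b_def)
  moreover have abc: "a + c * b > 0"
    using ab \<open>c > 0\<close> by (simp add: add_pos_pos)
  ultimately have "u + c *\<^sub>R p \<noteq> 0"
    by force
  have eqs: "slope \<theta>ID \<rho>ID \<theta>OOD \<rho>OOD u = C * (a' / a)"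
    "slope \<theta>ID \<rho>ID \<theta>OOD \<rho>OOD p = C * (b' / b)"
    "slope \<theta>ID \<rho>ID \<theta>OOD \<rho>OOD (u + c *\<^sub>R p) = C * ((a' + c * b') / (a + c * b))"
    using \<open>u + c *\<^sub>R p \<noteq> 0\<close> nz
    by (simp_all only: slope_eq C_def a_def b_def a'_def b'_def inner_add_right inner_scaleR_right not_False_eq_True)
  have "a' / a < b' / b"
    using less by (simp only: eqs mult_less_cancel_left_pos[OF C])
  have frac_less: "x / y < z / w \<longleftrightarrow> x * w < z * y" if "y > 0" "w > 0" for x y z w :: real
    using that by (simp add: field_simps)
  have "a' * b < b' * a"
    using \<open>a' / a < b' / b\<close> by (simp only: frac_less ab)
  \<comment> \<open>After cross-multiplication the terms common to both sides cancel, and the two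
    comparisons with the mediant reduce to this inequality and to the one before scaling by
    \<open>c\<close>.\<close>
  then have cross: "c * (a' * b) < c * (b' * a)"
    using \<open>c > 0\<close> by simp
  then have "a' / a < (a' + c * b') / (a + c * b)"
    unfolding frac_less[OF ab(1) abc] by (simp add: algebra_simps)
  moreover have "(a' + c * b') / (a + c * b) < b' / b"
    unfolding frac_less[OF abc ab(2)] using \<open>a' * b < b' * a\<close> by (simp add: algebra_simps)
  ultimately show "slope \<theta>ID \<rho>ID \<theta>OOD \<rho>OOD u < slope \<theta>ID \<rho>ID \<theta>OOD \<rho>OOD (u + c *\<^sub>R p)"
    "slope \<theta>ID \<rho>ID \<theta>OOD \<rho>OOD (u + c *\<^sub>R p) < slope \<theta>ID \<rho>ID \<theta>OOD \<rho>OOD p"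
    by (simp_all only: eqs mult_less_cancel_left_pos[OF C])
qed

text \<open>The slope does not change when \<open>w\<close> is replaced by \<open>- w\<close>, so a
  bound on it cannot determine the sign. With a negative denominator, slope below 1 means that
  \<open>cosine \<theta>OOD w * \<rho>OOD\<close> is the larger product, and then the OOD accuracy
  would be at least the ID accuracy.\<close>

lemma cosine_pos_if_accuracy_greater:
  fixes w :: "real ^ 'd"
  assumes "\<rho>ID > 0" "\<rho>OOD > 0" "\<theta>OOD \<noteq> 0" and nz: "cosine \<theta>ID w \<noteq> 0"
    and acc: "accuracy (data_dist \<theta>ID \<rho>ID) w > accuracy (data_dist \<theta>OOD \<rho>OOD) w"
    and slope: "slope \<theta>ID \<rho>ID \<theta>OOD \<rho>OOD w < 1"
  shows "cosine \<theta>ID w > 0"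
proof (rule ccontr)
  assume "\<not> cosine \<theta>ID w > 0"
  then have "cosine \<theta>ID w * \<rho>ID < 0"
    using nz \<open>\<rho>ID > 0\<close> by (simp add: mult_less_0_iff)
  then have "cosine \<theta>ID w * \<rho>ID < cosine \<theta>OOD w * \<rho>OOD"
    using slope by (simp add: slope_def divide_less_eq)
  moreover have "\<theta>ID \<noteq> 0" "w \<noteq> 0"
    using nz by (auto simp: cosine_def)
  ultimately show False
    using accuracy_mono[of \<theta>ID \<rho>ID \<theta>OOD \<rho>OOD w] assms by simp
qed

subsection \<open>Means of the trained models\<close>

context
  fixes M :: "'w measure" and n :: nat and \<theta> p :: "real ^ 'd" and \<rho> \<kappa> :: real
    and h :: "real \<Rightarrow> real"
    and X :: "nat \<Rightarrow> 'w \<Rightarrow> real ^ 'd" and Y :: "nat \<Rightarrow> 'w \<Rightarrow> real" and K :: "nat \<Rightarrow> 'w \<Rightarrow> bool"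
  assumes \<rho>: "\<rho> > 0" and n: "n \<ge> 1" and mono: "mono h" and nonneg: "\<And>t. h t \<ge> 0"
    and nonconst: "\<not> h constant_on UNIV" and \<kappa>: "\<kappa> > 0"
    and sample: "filtered_sample M n (data_dist \<theta> \<rho>) (\<lambda>(x, y). \<kappa> * h ((y *\<^sub>R x) \<bullet> p)) X Y K"
begin

interpretation prob_space M
  using sample by (simp add: filtered_sample_def)

lemma sample_measurable:
  assumes "i < n"
  shows "(\<lambda>\<omega>. (X i \<omega>, Y i \<omega>)) \<in> measurable M (borel \<Otimes>\<^sub>M borel)"
    and "K i \<in> measurable M (count_space UNIV)"
proof -
  have rv: "(\<lambda>\<omega>. ((X i \<omega>, Y i \<omega>), K i \<omega>)) \<in> measurable M ((borel \<Otimes>\<^sub>M borel) \<Otimes>\<^sub>M count_space UNIV)"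
    using sample assms by (auto simp: filtered_sample_def indep_vars_def)
  show "(\<lambda>\<omega>. (X i \<omega>, Y i \<omega>)) \<in> measurable M (borel \<Otimes>\<^sub>M borel)"
    "K i \<in> measurable M (count_space UNIV)"
    using measurable_compose[OF rv measurable_fst] measurable_compose[OF rv measurable_snd] by simp_all
qed

lemma sample_distr: "i < n \<Longrightarrow> distr M (borel \<Otimes>\<^sub>M borel) (\<lambda>\<omega>. (X i \<omega>, Y i \<omega>)) = data_dist \<theta> \<rho>"
  using sample by (simp add: filtered_sample_def)

text \<open>Sample 0 exists and its law has mass 1, whereas the data distribution with mean 0 has
  mass 0.\<close>

lemma train_nonzero: "\<theta> \<noteq> 0"
proof
  assume "\<theta> = 0"
  then have "prob_space (data_dist (0 :: real ^ 'd) \<rho>)"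
    using prob_space_distr[OF sample_measurable(1)[of 0]] sample_distr[of 0] n by simp
  then show False
    using data_dist_0_not_prob_space[OF \<rho>] by blast
qed

lemma signed_sample_distr:
  assumes "i < n"
  shows "distr M borel (\<lambda>\<omega>. Y i \<omega> *\<^sub>R X i \<omega>) =
    distr std_gauss borel (\<lambda>x. \<theta> + (norm \<theta> / \<rho>) *\<^sub>R x)"
proof -
  have "distr M borel (\<lambda>\<omega>. Y i \<omega> *\<^sub>R X i \<omega>) = distr (data_dist \<theta> \<rho>) borel (\<lambda>(x, y). y *\<^sub>R x)"
    unfolding sample_distr[OF assms, symmetric]
    by (subst distr_distr) (auto simp: comp_def sample_measurable assms)
  then show ?thesis
    using train_nonzero \<rho> by (simp add: data_dist_signed isotropic_normal_affine[of _ \<theta>])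
qed

lemma signed_sample_measurable: "i < n \<Longrightarrow> (\<lambda>\<omega>. Y i \<omega> *\<^sub>R X i \<omega>) \<in> borel_measurable M"
  using measurable_compose[OF sample_measurable(1), of i "\<lambda>(x, y). y *\<^sub>R x" borel] by simp

lemma
  fixes f :: "real ^ 'd \<Rightarrow> 'b::{banach, second_countable_topology}"
  assumes "i < n" and f [measurable]: "f \<in> borel_measurable borel"
  shows integral_signed_sample: "(LINT \<omega>|M. f (Y i \<omega> *\<^sub>R X i \<omega>)) =
      (LINT x|std_gauss. f (\<theta> + (norm \<theta> / \<rho>) *\<^sub>R x))"
    and integrable_signed_sample: "integrable M (\<lambda>\<omega>. f (Y i \<omega> *\<^sub>R X i \<omega>)) \<longleftrightarrow>
      integrable std_gauss (\<lambda>x. f (\<theta> + (norm \<theta> / \<rho>) *\<^sub>R x))"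
  using integral_distr[OF signed_sample_measurable[OF assms(1)] f]
    integrable_distr_eq[OF signed_sample_measurable[OF assms(1)] f]
    signed_sample_distr[OF assms(1)]
    integral_distr[of "\<lambda>x. \<theta> + (norm \<theta> / \<rho>) *\<^sub>R x" std_gauss borel f]
    integrable_distr_eq[of "\<lambda>x. \<theta> + (norm \<theta> / \<rho>) *\<^sub>R x" std_gauss borel f] f
  by simp_all

lemma affine_std_gauss:
  "integrable std_gauss (\<lambda>x. \<theta> + s *\<^sub>R x)" "(LINT x|std_gauss. \<theta> + s *\<^sub>R x) = \<theta>"
proof -
  interpret G: prob_space "std_gauss :: (real ^ 'd) measure"
    by (rule prob_space_std_gauss)
  have 1: "integrable std_gauss (\<lambda>_ :: real ^ 'd. \<theta>)" and 2: "integrable std_gauss (\<lambda>x :: real ^ 'd. s *\<^sub>R x)"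
    by (auto intro: integrable_std_gauss)
  show "integrable std_gauss (\<lambda>x. \<theta> + s *\<^sub>R x)"
    using 1 2 by (rule Bochner_Integration.integrable_add)
  show "(LINT x|std_gauss. \<theta> + s *\<^sub>R x) = \<theta>"
    using Bochner_Integration.integral_add[OF 1 2] G.prob_space by (simp add: integral_std_gauss)
qed

lemma integrable_signed: "i < n \<Longrightarrow> integrable M (\<lambda>\<omega>. Y i \<omega> *\<^sub>R X i \<omega>)"
  and mean_signed: "i < n \<Longrightarrow> (LINT \<omega>|M. Y i \<omega> *\<^sub>R X i \<omega>) = \<theta>"
  using integrable_signed_sample[of i "\<lambda>z. z"] integral_signed_sample[of i "\<lambda>z. z"]
  by (simp_all add: affine_std_gauss)

lemma mean_unfiltered_eq: "mean_unfiltered M n X Y = \<theta>"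
proof -
  have "mean_unfiltered M n X Y = (1 / real n) *\<^sub>R (\<Sum>i<n. (LINT \<omega>|M. Y i \<omega> *\<^sub>R X i \<omega>))"
    unfolding mean_unfiltered_def trained_model_def
    using integrable_signed by (simp add: Bochner_Integration.integral_sum)
  also have "\<dots> = \<theta>"
    using n by (simp add: mean_signed sum_constant_scaleR del: sum_constant)
  finally show ?thesis .
qed

lemma mean_filtered_eq:
  assumes "p \<noteq> 0"
  shows "\<exists>c>0. mean_filtered M n X Y K = \<theta> + c *\<^sub>R p"
proof -
  interpret G: prob_space "std_gauss :: (real ^ 'd) measure"
    by (rule prob_space_std_gauss)
  define s where "s = norm \<theta> / \<rho>"
  have s: "s > 0"
    using train_nonzero \<rho> by (simp add: s_def)
  define q where "q z = \<kappa> * h (z \<bullet> p)" for z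
  \<comment> \<open>\<open>f\<close> is the keeping probability as a function of the standardised
    projection \<open>u = x \<bullet> p\<close>, where the signed point is
    \<open>\<theta> + s *\<^sub>R x\<close>.\<close>
  define f where "f u = \<kappa> * h (\<theta> \<bullet> p + s * u)" for u
  have [measurable]: "h \<in> borel_measurable borel"
    using mono by (rule borel_measurable_mono)
  have q_meas [measurable]: "q \<in> borel_measurable borel"
    unfolding q_def by measurable
  have qf: "q (\<theta> + s *\<^sub>R x) = f (x \<bullet> p)" for x
    by (simp add: q_def f_def inner_add_left)
  have f_mono: "mono f"
    using s \<kappa> by (intro monoI) (simp add: f_def monoD[OF mono])
  have f_nonneg: "0 \<le> f u" for u
    using \<kappa> nonneg by (simp add: f_def)
  have f_nonconst: "\<not> f constant_on UNIV"
  proof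
    assume "f constant_on UNIV"
    then obtain y where y: "f u = y" for u
      by (auto simp: constant_on_def)
    have "h t = y / \<kappa>" for t
      using y[of "(t - \<theta> \<bullet> p) / s"] s \<kappa> by (simp add: f_def field_simps)
    then show False
      using nonconst by (auto simp: constant_on_def)
  qed
  have cond: "AE \<omega> in M. real_cond_exp M
      (vimage_algebra (space M) (\<lambda>\<omega>. (X i \<omega>, Y i \<omega>)) (borel \<Otimes>\<^sub>M borel))
      (indicator {\<omega> \<in> space M. K i \<omega>}) \<omega> = (\<lambda>(x, y). q (y *\<^sub>R x)) (X i \<omega>, Y i \<omega>)" if "i < n" for i
    using sample that by (simp add: filtered_sample_def q_def)
  have q_pair: "(\<lambda>(x, y). q (y *\<^sub>R x)) \<in> borel_measurable (borel \<Otimes>\<^sub>M borel)"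
    by measurable
  \<comment> \<open>The bound is moved from the sample to its law and then to the standard Gaussian,
    where full support and monotonicity give \<open>f u \<le> 1\<close> for every
    \<open>u\<close>.\<close>
  have "AE \<omega> in M. q (Y 0 \<omega> *\<^sub>R X 0 \<omega>) \<le> 1"
    using cond_prob_le_1[OF sample_measurable cond q_pair, of 0] n by simp
  then have "AE z in distr M borel (\<lambda>\<omega>. Y 0 \<omega> *\<^sub>R X 0 \<omega>). q z \<le> 1"
    using n by (subst AE_distr_iff) (auto intro: signed_sample_measurable)
  then have "AE x in std_gauss. f (x \<bullet> p) \<le> 1"
    using n by (subst (asm) signed_sample_distr, simp, subst (asm) AE_distr_iff)
      (auto simp: qf s_def[symmetric])
  then have "\<exists>r>u. f r \<le> 1" for u
    using std_gauss_AE_ridge[OF \<open>p \<noteq> 0\<close>, of "\<lambda>r. f r \<le> 1"] by blast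
  then have f_le_1: "f u \<le> 1" for u
    using monoD[OF f_mono, of u] by (metis less_imp_le order_trans)
  have f_meas [measurable]: "f \<in> borel_measurable borel"
    using f_mono by (rule borel_measurable_mono)
  define \<pi> where "\<pi> = (LINT x|std_gauss. f (x \<bullet> p))"
  have \<pi>: "\<pi> > 0"
    unfolding \<pi>_def
    using \<open>p \<noteq> 0\<close> f_mono f_nonneg f_le_1 f_nonconst by (rule std_gauss_ridge_mass_pos)
  have f_abs: "\<bar>f u\<bar> \<le> 1" for u
    using f_nonneg[of u] f_le_1[of u] by simp
  obtain c where c: "c > 0" "(LINT x|std_gauss. f (x \<bullet> p) *\<^sub>R x) = c *\<^sub>R p"
    using std_gauss_ridge_mean[OF \<open>p \<noteq> 0\<close> f_mono f_abs f_nonconst] by blast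
  have int_f: "integrable std_gauss (\<lambda>x. f (x \<bullet> p))"
    by (rule G.integrable_const_bound[where B = 1]) (simp_all add: f_abs)
  have int_fx: "integrable std_gauss (\<lambda>x. f (x \<bullet> p) *\<^sub>R x)"
    by (rule integrable_std_gauss_bounded_mult[where B = 1]) (simp_all add: f_abs)
  have kept: "(LINT \<omega>|M. of_bool (K i \<omega>) * g (Y i \<omega> *\<^sub>R X i \<omega>)) =
      (LINT x|std_gauss. f (x \<bullet> p) * g (\<theta> + s *\<^sub>R x))"
    if i: "i < n" and [measurable]: "g \<in> borel_measurable borel"
      and "integrable M (\<lambda>\<omega>. g (Y i \<omega> *\<^sub>R X i \<omega>))" for i and g :: "real ^ 'd \<Rightarrow> real"
  proof -
    have "(LINT \<omega>|M. of_bool (K i \<omega>) * g (Y i \<omega> *\<^sub>R X i \<omega>)) =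
        (LINT \<omega>|M. q (Y i \<omega> *\<^sub>R X i \<omega>) * g (Y i \<omega> *\<^sub>R X i \<omega>))"
      using integral_cond_prob[OF sample_measurable[OF i] cond[OF i] q_pair,
          of "\<lambda>(x, y). g (y *\<^sub>R x)"] that by simp
    also have "\<dots> = (LINT x|std_gauss. f (x \<bullet> p) * g (\<theta> + s *\<^sub>R x))"
      using integral_signed_sample[OF i, of "\<lambda>z. q z * g z"] by (simp add: s_def[symmetric] qf)
    finally show ?thesis .
  qed
  \<comment> \<open>The constant part \<theta> of the signed point is weighted by the keeping mass
    \<pi>, and the Gaussian part contributes \<open>s\<close> times the ridge mean
    \<open>c *\<^sub>R p\<close>. Dividing by \<pi> leaves \<theta> plus a positive multiple of
    \<open>p\<close>.\<close>
  have V: "(LINT \<omega>|M. of_bool (K i \<omega>) *\<^sub>R Y i \<omega> *\<^sub>R X i \<omega>) = \<pi> *\<^sub>R \<theta> + (s * c) *\<^sub>R p" if i: "i < n" for i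
  proof (rule euclidean_eqI)
    fix b :: "real ^ 'd"
    have K_meas: "(\<lambda>\<omega>. of_bool (K i \<omega>) :: real) \<in> borel_measurable M"
      using sample_measurable(2)[OF i] by measurable
    have KZ_meas: "(\<lambda>\<omega>. of_bool (K i \<omega>) *\<^sub>R Y i \<omega> *\<^sub>R X i \<omega>) \<in> borel_measurable M"
      by (rule borel_measurable_scaleR[OF K_meas signed_sample_measurable[OF i]])
    have int: "integrable M (\<lambda>\<omega>. of_bool (K i \<omega>) *\<^sub>R Y i \<omega> *\<^sub>R X i \<omega>)"
      by (rule Bochner_Integration.integrable_bound[OF integrable_signed[OF i] KZ_meas]) auto
    have "(LINT \<omega>|M. of_bool (K i \<omega>) *\<^sub>R Y i \<omega> *\<^sub>R X i \<omega>) \<bullet> b =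
        (LINT \<omega>|M. of_bool (K i \<omega>) * ((Y i \<omega> *\<^sub>R X i \<omega>) \<bullet> b))"
      using integral_inner_left[OF int, of b] by (simp add: mult.assoc)
    also have "\<dots> = (LINT x|std_gauss. f (x \<bullet> p) * ((\<theta> + s *\<^sub>R x) \<bullet> b))"
      using integrable_inner_left[OF integrable_signed[OF i], of b]
      by (intro kept[OF i, of "\<lambda>z. z \<bullet> b"]) simp_all
    also have "\<dots> = (LINT x|std_gauss. (\<theta> \<bullet> b) * f (x \<bullet> p) + s * ((f (x \<bullet> p) *\<^sub>R x) \<bullet> b))"
      by (simp add: inner_add_left algebra_simps)
    also have "\<dots> = (\<theta> \<bullet> b) * \<pi> + s * ((LINT x|std_gauss. f (x \<bullet> p) *\<^sub>R x) \<bullet> b)"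
      unfolding \<pi>_def integral_inner_left[OF int_fx, symmetric]
      using int_f integrable_inner_left[OF int_fx, of b]
      by (subst Bochner_Integration.integral_add) simp_all
    finally show "(LINT \<omega>|M. of_bool (K i \<omega>) *\<^sub>R Y i \<omega> *\<^sub>R X i \<omega>) \<bullet> b = (\<pi> *\<^sub>R \<theta> + (s * c) *\<^sub>R p) \<bullet> b"
      unfolding c by (simp add: inner_add_left algebra_simps)
  qed
  have K_mass: "(LINT \<omega>|M. of_bool (K i \<omega>)) = \<pi>" if "i < n" for i
    unfolding \<pi>_def using kept[OF that borel_measurable_const integrable_const, of 1]
    by (simp only: mult_1_right)
  have "indep_vars (\<lambda>_. (borel \<Otimes>\<^sub>M borel) \<Otimes>\<^sub>M count_space UNIV) (\<lambda>i \<omega>. ((X i \<omega>, Y i \<omega>), K i \<omega>)) {..<n}"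
    using sample by (simp add: filtered_sample_def)
  then have "indep_vars (\<lambda>_. borel \<Otimes>\<^sub>M count_space UNIV)
      (\<lambda>i \<omega>. (\<lambda>w. (snd (fst w) *\<^sub>R fst (fst w), snd w)) ((X i \<omega>, Y i \<omega>), K i \<omega>)) {..<n}"
  proof (rule indep_vars_compose2)
    let ?N = "(borel \<Otimes>\<^sub>M borel) \<Otimes>\<^sub>M count_space UNIV :: (((real ^ 'd) \<times> real) \<times> bool) measure"
    have "(\<lambda>w. snd (fst w) *\<^sub>R fst (fst w)) \<in> borel_measurable ?N"
      by measurable
    then show "(\<lambda>w. (snd (fst w) *\<^sub>R fst (fst w), snd w)) \<in> measurable ?N (borel \<Otimes>\<^sub>M count_space UNIV)"
      using measurable_snd by (rule measurable_Pair)
  qed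
  then have "mean_filtered M n X Y K = (1 / \<pi>) *\<^sub>R (\<pi> *\<^sub>R \<theta> + (s * c) *\<^sub>R p)"
    unfolding mean_filtered_def trained_model_def
    using integrable_signed V K_mass n \<pi>
    by (intro integral_thinned_average) simp_all
  also have "\<dots> = \<theta> + (s * c / \<pi>) *\<^sub>R p"
    using \<pi> by (simp add: scaleR_add_right)
  finally show ?thesis
    using s c \<pi> by (intro exI[of _ "s * c / \<pi>"]) simp
qed

end

theorem theorem3:
  fixes \<theta>train \<theta>ID \<theta>OOD \<theta>pre :: "real ^ 'd"
    and \<rho> \<rho>ID \<rho>OOD \<kappa> :: real
    and n :: nat
    and h :: "real \<Rightarrow> real"
    and M :: "'w measure"
    and X :: "nat \<Rightarrow> 'w \<Rightarrow> real ^ 'd"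
    and Y :: "nat \<Rightarrow> 'w \<Rightarrow> real"
    and K :: "nat \<Rightarrow> 'w \<Rightarrow> bool"
  assumes "\<rho> > 0" and "\<rho>ID > 0" and "\<rho>OOD > 0" and "n \<ge> 1"
    and "mono h" and "\<And>t. h t \<ge> 0" and "\<not> h constant_on UNIV" and "\<kappa> > 0"
    and "filtered_sample M n (data_dist \<theta>train \<rho>) (\<lambda>(x, y). \<kappa> * h ((y *\<^sub>R x) \<bullet> \<theta>pre)) X Y K"
    and "\<And>\<theta>. \<theta> \<in> {mean_unfiltered M n X Y, \<theta>pre} \<Longrightarrow> cosine \<theta>ID \<theta> \<noteq> 0"
    and "\<And>\<theta>. \<theta> \<in> {mean_unfiltered M n X Y, \<theta>pre} \<Longrightarrow>
           accuracy (data_dist \<theta>ID \<rho>ID) \<theta> > accuracy (data_dist \<theta>OOD \<rho>OOD) \<theta>"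
    and "\<And>\<theta>. \<theta> \<in> {mean_unfiltered M n X Y, \<theta>pre} \<Longrightarrow> slope \<theta>ID \<rho>ID \<theta>OOD \<rho>OOD \<theta> < 1"
    and "slope \<theta>ID \<rho>ID \<theta>OOD \<rho>OOD (mean_unfiltered M n X Y) < slope \<theta>ID \<rho>ID \<theta>OOD \<rho>OOD \<theta>pre"
    and "slope \<theta>ID \<rho>ID \<theta>OOD \<rho>OOD \<theta>pre \<le> 1"
  shows "slope \<theta>ID \<rho>ID \<theta>OOD \<rho>OOD (mean_unfiltered M n X Y)
           < slope \<theta>ID \<rho>ID \<theta>OOD \<rho>OOD (mean_filtered M n X Y K) \<and>
         slope \<theta>ID \<rho>ID \<theta>OOD \<rho>OOD (mean_filtered M n X Y K) \<le> slope \<theta>ID \<rho>ID \<theta>OOD \<rho>OOD \<theta>pre"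
proof -
  have unf: "mean_unfiltered M n X Y = \<theta>train"
    by (rule mean_unfiltered_eq[OF assms(1,4-9)])
  have "\<theta>pre \<noteq> 0"
    using assms(10)[of \<theta>pre] by (auto simp: cosine_def)
  then obtain c where c: "c > 0" "mean_filtered M n X Y K = \<theta>train + c *\<^sub>R \<theta>pre"
    using mean_filtered_eq[OF assms(1,4-9)] by blast
  have "\<theta>OOD \<noteq> 0"
    using assms(13) slope_zero_OOD[of \<theta>ID \<rho>ID \<rho>OOD] by auto
  then have pos: "cosine \<theta>ID w > 0" if "w \<in> {mean_unfiltered M n X Y, \<theta>pre}" for w
    using assms(2,3) assms(10-12)[OF that] by (intro cosine_pos_if_accuracy_greater)
  show ?thesis
    \<comment> \<open>The mediant inequality gives both bounds strictly; the upper one is weakened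
      to match the claim.\<close>
    using slope_add_between[OF assms(2,3) c(1) pos[of \<theta>train] pos[of \<theta>pre]] assms(13)
    by (simp add: unf c less_imp_le)
qed

end
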